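(* Let $n\ge 1$ and consider the mechanical system (a quadrotor with a cable-suspended payload, the cable being a chain of $n$ links) with configuration $(x,R,q_1,\dots,q_n)\in\mathbb{R}^3\times\mathsf{SO}(3)\times(\mathsf{S}^2)^n$ and Lagrangian $L=T-V$, $$T=\tfrac12 M_{00}\|\dot x\|^2+\dot x\cdot\sum_{i=1}^n M_{0i}\dot q_i+\tfrac12\sum_{i,j=1}^n M_{ij}\,\dot q_i\cdot\dot q_j+\tfrac12\,\Omega^T J\Omega,$$ $$V=-\sum_{i=1}^n\sum_{a=i}^n m_a g l_i\, e_3\cdot q_i-M_{00}\,g\,e_3\cdot x,$$ where $\dot R=R\hat\Omega$, subject to the external force $-fRe_3$ (in the inertial frame, conjugate to $x$) and the external moment $M\in\mathbb{R}^3$ (in the body-fixed frame). Then the Euler-Lagrange equations (with external force and moment) are $$M_{00}\ddot x+\sum_{i=1}^n M_{0i}\ddot q_i=-fRe_3+M_{00}ge_3,\qquad (\mathrm a)$$ $$M_{ii}\ddot q_i-\hat q_i^2\Big(M_{i0}\ddot x+\sum_{j=1,\,j\ne i}^n M_{ij}\ddot q_j\Big)=-M_{ii}\|\dot q_i\|^2q_i-\sum_{a=i}^n m_a g l_i\,\hat q_i^2e_3\quad(1\le i\le n),\qquad (\mathrm b)$$ $$J\dot\Omega+\hat\Omega J\Omega=M.\qquad (\mathrm c)$$ Equations (a) and (b) can be rewritten in matrix form as $$\begin{bmatrix} M_{00}&M_{01}&M_{02}&\cdots&M_{0n}\\ -\hat q_1^2M_{10}&M_{11}I_3&-M_{12}\hat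 q_1^2&\cdots&-M_{1n}\hat q_1^2\\ -\hat q_2^2M_{20}&-M_{21}\hat q_2^2&M_{22}I_3&\cdots&-M_{2n}\hat q_2^2\\ \vdots&\vdots&\vdots&&\vdots\\ -\hat q_n^2M_{n0}&-M_{n1}\hat q_n^2&-M_{n2}\hat q_n^2&\cdots&M_{nn}I_3\end{bmatrix}\begin{bmatrix}\ddot x\\ \ddot q_1\\ \ddot q_2\\ \vdots\\ \ddot q_n\end{bmatrix}=\begin{bmatrix}-fRe_3+M_{00}ge_3\\ -\|\dot q_1\|^2M_{11}q_1-\sum_{a=1}^n m_agl_1\hat q_1^2e_3\\ -\|\dot q_2\|^2M_{22}q_2-\sum_{a=2}^n m_agl_2\hat q_2^2e_3\\ \vdots\\ -\|\dot q_n\|^2M_{nn}q_n-m_ngl_n\hat q_n^2e_3\end{bmatrix}.$$ Equivalently, in terms of the link angular velocities $\omega_i\in\mathbb{R}^3$ (with $q_i\cdot\omega_i=0$), they can be written as $$\begin{bmatrix} M_{00}&-M_{01}\hat q_1&-M_{02}\hat q_2&\cdots&-M_{0n}\hat q_n\\ \hat q_1M_{10}&M_{11}I_3&-M_{12}\hat q_1\hat q_2&\cdots&-M_{1n}\hat q_1\hat q_n\\ \hat q_2M_{20}&-M_{21}\hat q_2\hat q_1&M_{22}I_3&\cdots&-M_{2n}\hat q_2\hat q_n\\ \vdots&\vdots&\vdots&&\vdots\\ \hat q_nM_{n0}&-M_{n1}\hat q_n\hat q_1&-M_{n2}\hat q_n\hat q_2&\cdots&M_{nn}I_3\end{bmatrix}\begin{bmatrix}\ddot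 x\\ \dot\omega_1\\ \dot\omega_2\\ \vdots\\ \dot\omega_n\end{bmatrix}=\begin{bmatrix}\sum_{j=1}^nM_{0j}\|\omega_j\|^2q_j-fRe_3+M_{00}ge_3\\ \sum_{j=2}^nM_{1j}\|\omega_j\|^2\hat q_1q_j+\sum_{a=1}^nm_agl_1\hat q_1e_3\\ \sum_{j=1,\,j\ne2}^nM_{2j}\|\omega_j\|^2\hat q_2q_j+\sum_{a=2}^nm_agl_2\hat q_2e_3\\ \vdots\\ \sum_{j=1}^{n-1}M_{nj}\|\omega_j\|^2\hat q_nq_j+m_ngl_n\hat q_ne_3\end{bmatrix},$$ $$\dot q_i=\omega_i\times q_i\quad(1\le i\le n).$$
   Context: Notation. $e_1,e_2,e_3$ is the standard basis of $\mathbb{R}^3$ (inertial frame; $e_3$ is the direction of gravity), $g$ is the gravitational acceleration. $\mathsf{SO}(3)=\{R\in\mathbb{R}^{3\times3}: R^TR=I_3,\ \det R=1\}$, $\mathsf{S}^2=\{q\in\mathbb{R}^3:\|q\|=1\}$. The hat map $\hat{\cdot}:\mathbb{R}^3\to\mathfrak{so}(3)$ is defined by $\hat x y=x\times y$ for all $x, y\in\mathbb{R}^3$. In block matrices, a scalar entry standing for a $3\times3$ block denotes that scalar times $I_3$. System. $x\in\mathbb{R}^3$ is the position of the quadrotor's mass center, $R\in\mathsf{SO}(3)$ its attitude (body-fixed to inertial frame), $\Omega\in\mathbb{R}^3$ its body-fixed angular velocity, so $\dot R=R\hat\Omega$; $m>0$ is its mass and $J\in\mathbb{R}^{3\times3}$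 its (symmetric positive-definite) inertia matrix. $q_i\in\mathsf{S}^2$ is the direction of the $i$-th link (measured from the quadrotor toward the payload), with length $l_i>0$ and mass $m_i>0$ concentrated at its outboard end; thus mass $m_i$ is located at $x_i=x+\sum_{a=1}^i l_aq_a$, and the first link is attached at the quadrotor's mass center. The angular velocity $\omega_i\in\mathbb{R}^3$ of the $i$-th link (inertial frame) satisfies $q_i\cdot\omega_i=0$ and $\dot q_i=\omega_i\times q_i$. The inputs are the total thrust magnitude $f\in\mathbb{R}$ and the moment $M\in\mathbb{R}^3$. Inertia constants. $M_{00}=m+\sum_{i=1}^nm_i$, $M_{0i}=M_{i0}=\sum_{a=i}^nm_al_i$, $M_{ij}=\Big(\sum_{a=\max\{i,j\}}^nm_a\Big)l_il_j$ for $1\le i,j\le n$. Euler-Lagrange equations. These are the equations obtained from the Lagrange-d'Alembert principle $\delta\int_{t_0}^{t_f}L\,dt+\int_{t_0}^{t_f}\big(-fRe_3\cdot\delta x+M\cdot\eta\big)\,dt=0$ for all variations vanishing at the end points, of the form $\delta x\in\mathbb{R}^3$ arbitrary, $\delta R=R\hat\eta$ with $\eta\in\mathbb{R}^3$ (so $\delta\Omega=\dot\eta+\Omega\times\eta$), and $\delta q_i=\xi_i\times q_i$ with $\xi_i\in\mathbb{R}^3$, $\xi_i\cdot q_i=0$. *)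

theory Defs
  imports "HOL-Analysis.Analysis"
begin

definition hat :: "real^3 \<Rightarrow> real^3^3"
  where "hat x = matrix (\<lambda>y. cross3 x y)"

lemma hat_mult_vec: "hat x *v y = cross3 x y"
proof -
  have "linear (\<lambda>y. cross3 x y)"
    by (rule bounded_linear.linear, rule bounded_bilinear.bounded_linear_right)
      (rule bilinear_cross [unfolded bilinear_conv_bounded_bilinear])
  then show ?thesis
    unfolding hat_def by simp
qed

abbreviation e3 :: "real^3"
  where "e3 \<equiv> axis 3 1"

text \<open>Physical parameters. Links are numbered from 1 to \<open>num_links P\<close>, starting at the quadrotor;
  the values of \<open>link_mass P\<close> and \<open>link_length P\<close> outside this range are irrelevant.\<close>

record quadrotor =
  num_links :: nat
  body_mass :: real
  body_inertia :: "real^3^3"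
  link_mass :: "nat \<Rightarrow> real"
  link_length :: "nat \<Rightarrow> real"
  gravity :: real

text \<open>The constants \<open>M\<^sub>i\<^sub>j\<close> for \<open>0 \<le> i, j \<le> n\<close>; index 0 stands for the quadrotor.\<close>

definition inertia_const :: "quadrotor \<Rightarrow> nat \<Rightarrow> nat \<Rightarrow> real"
  where "inertia_const P i j =
    (if i = 0 \<and> j = 0 then body_mass P + (\<Sum>a=1..num_links P. link_mass P a)
     else if i = 0 then (\<Sum>a=j..num_links P. link_mass P a * link_length P j)
     else if j = 0 then (\<Sum>a=i..num_links P. link_mass P a * link_length P i)
     else (\<Sum>a=max i j..num_links P. link_mass P a) * link_length P i * link_length P j)"

definition kinetic_energy ::
    "quadrotor \<Rightarrow> real^3 \<Rightarrow> real^3 \<Rightarrow> (nat \<Rightarrow> real^3) \<Rightarrow> real"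
  where "kinetic_energy P v \<Omega> w =
    1/2 * inertia_const P 0 0 * (norm v)\<^sup>2
    + v \<bullet> (\<Sum>i=1..num_links P. inertia_const P 0 i *\<^sub>R w i)
    + 1/2 * (\<Sum>i=1..num_links P. \<Sum>j=1..num_links P. inertia_const P i j * (w i \<bullet> w j))
    + 1/2 * (\<Omega> \<bullet> (body_inertia P *v \<Omega>))"

definition potential_energy :: "quadrotor \<Rightarrow> real^3 \<Rightarrow> (nat \<Rightarrow> real^3) \<Rightarrow> real"
  where "potential_energy P x q =
    - (\<Sum>i=1..num_links P. \<Sum>a=i..num_links P.
          link_mass P a * gravity P * link_length P i * (e3 \<bullet> q i))
    - inertia_const P 0 0 * gravity P * (e3 \<bullet> x)"

definition lagrangian ::
    "quadrotor \<Rightarrow> real^3 \<Rightarrow> (nat \<Rightarrow> real^3) \<Rightarrow> real^3 \<Rightarrow> real^3 \<Rightarrow> (nat \<Rightarrow> real^3) \<Rightarrow> real"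
  where "lagrangian P x q v \<Omega> w = kinetic_energy P v \<Omega> w - potential_energy P x q"

text \<open>Curves are considered on a compact time interval \<open>{t0..tf}\<close>, with one-sided derivatives
  at its end points.\<close>

definition time_deriv :: "real \<Rightarrow> real \<Rightarrow> (real \<Rightarrow> 'a::real_normed_vector) \<Rightarrow> real \<Rightarrow> 'a"
  where "time_deriv t0 tf c t = vector_derivative c (at t within {t0..tf})"

definition body_angular_velocity :: "real \<Rightarrow> real \<Rightarrow> (real \<Rightarrow> real^3^3) \<Rightarrow> real \<Rightarrow> real^3"
  where "body_angular_velocity t0 tf R t = (THE \<Omega>. time_deriv t0 tf R t = R t ** hat \<Omega>)"

lemma hat_inject: "hat v = hat w \<longleftrightarrow> v = w"
proof
  assume "hat v = hat w"
  then have "cross3 v y = cross3 w y" for y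
    by (metis hat_mult_vec)
  from this [of "axis 1 1"] this [of "axis 2 1"] show "v = w"
    by (simp add: cross3_def vec_eq_iff forall_3 axis_def)
qed simp

lemma body_angular_velocity_eq:
  assumes "t0 < tf" "t \<in> {t0..tf}" "rotation_matrix (R t)"
    and "(R has_vector_derivative R t ** hat \<Omega>) (at t within {t0..tf})"
  shows "body_angular_velocity t0 tf R t = \<Omega>"
proof -
  have deriv: "time_deriv t0 tf R t = R t ** hat \<Omega>"
    using vector_derivative_within_cbox [of t0 tf t R] assms(1,2,4)
    by (simp add: time_deriv_def)
  have "R t ** hat \<Omega> = R t ** hat w \<Longrightarrow> w = \<Omega>" for w
    using assms(3) unfolding rotation_matrix_def orthogonal_matrix_def
    by (metis hat_inject matrix_mul_assoc matrix_mul_lid)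
  then show ?thesis
    unfolding body_angular_velocity_def deriv by blast
qed

definition action ::
    "quadrotor \<Rightarrow> real \<Rightarrow> real \<Rightarrow> (real \<Rightarrow> real^3) \<Rightarrow> (real \<Rightarrow> real^3^3) \<Rightarrow> (nat \<Rightarrow> real \<Rightarrow> real^3) \<Rightarrow> real"
  where "action P t0 tf x R q =
    integral {t0..tf} (\<lambda>t. lagrangian P (x t) (\<lambda>i. q i t) (time_deriv t0 tf x t)
      (body_angular_velocity t0 tf R t) (\<lambda>i. time_deriv t0 tf (q i) t))"

text \<open>Families \<open>F s t\<close> of curves, with parameter \<open>s \<in> {-e<..<e}\<close> and time \<open>t \<in> {a..b}\<close>, that are
  jointly of class C1 (with partial derivatives \<open>Fs\<close> and \<open>Ft\<close>) or of class C2.\<close>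

definition C1_family ::
    "real \<Rightarrow> real \<Rightarrow> real \<Rightarrow> (real \<Rightarrow> real \<Rightarrow> 'a::real_normed_vector) \<Rightarrow>
      (real \<Rightarrow> real \<Rightarrow> 'a) \<Rightarrow> (real \<Rightarrow> real \<Rightarrow> 'a) \<Rightarrow> bool"
  where "C1_family e a b F Fs Ft \<longleftrightarrow>
    (\<forall>s\<in>{-e<..<e}. \<forall>t\<in>{a..b}.
       ((\<lambda>s. F s t) has_vector_derivative Fs s t) (at s) \<and>
       ((\<lambda>t. F s t) has_vector_derivative Ft s t) (at t within {a..b})) \<and>
    continuous_on ({-e<..<e} \<times> {a..b}) (\<lambda>(s, t). Fs s t) \<and>
    continuous_on ({-e<..<e} \<times> {a..b}) (\<lambda>(s, t). Ft s t)"

definition C2_family ::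
    "real \<Rightarrow> real \<Rightarrow> real \<Rightarrow> (real \<Rightarrow> real \<Rightarrow> 'a::real_normed_vector) \<Rightarrow> bool"
  where "C2_family e a b F \<longleftrightarrow>
    (\<exists>Fs Ft Fss Fst Fts Ftt. C1_family e a b F Fs Ft \<and>
       C1_family e a b Fs Fss Fst \<and> C1_family e a b Ft Fts Ftt)"

text \<open>\<open>(X s, A s, Q s)\<close> is a family of curves in the configuration manifold that passes through
  \<open>(x, R, q)\<close> at \<open>s = 0\<close>. Its infinitesimal variation is \<open>\<delta>x\<close>, \<open>\<delta>R = R ** hat \<eta>\<close>,
  \<open>\<delta>q i = \<xi> i \<times> q i\<close> and vanishes at the end points.\<close>

definition variation ::
    "nat \<Rightarrow> real \<Rightarrow> real \<Rightarrow> (real \<Rightarrow> real^3) \<Rightarrow> (real \<Rightarrow> real^3^3) \<Rightarrow> (nat \<Rightarrow> real \<Rightarrow> real^3) \<Rightarrow>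
      real \<Rightarrow> (real \<Rightarrow> real \<Rightarrow> real^3) \<Rightarrow> (real \<Rightarrow> real \<Rightarrow> real^3^3) \<Rightarrow> (real \<Rightarrow> nat \<Rightarrow> real \<Rightarrow> real^3) \<Rightarrow>
      (real \<Rightarrow> real^3) \<Rightarrow> (real \<Rightarrow> real^3) \<Rightarrow> (nat \<Rightarrow> real \<Rightarrow> real^3) \<Rightarrow> bool"
  where "variation n t0 tf x R q e X A Q \<delta>x \<eta> \<xi> \<longleftrightarrow>
    0 < e \<and>
    C2_family e t0 tf X \<and> C2_family e t0 tf A \<and>
    (\<forall>i\<in>{1..n}. C2_family e t0 tf (\<lambda>s. Q s i)) \<and>
    (\<forall>s\<in>{-e<..<e}. \<forall>t\<in>{t0..tf}.
       rotation_matrix (A s t) \<and> (\<forall>i\<in>{1..n}. norm (Q s i t) = 1)) \<and>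
    (\<forall>t\<in>{t0..tf}. X 0 t = x t \<and> A 0 t = R t \<and> (\<forall>i\<in>{1..n}. Q 0 i t = q i t)) \<and>
    (\<forall>t\<in>{t0..tf}.
       ((\<lambda>s. X s t) has_vector_derivative \<delta>x t) (at 0) \<and>
       ((\<lambda>s. A s t) has_vector_derivative R t ** hat (\<eta> t)) (at 0) \<and>
       (\<forall>i\<in>{1..n}. ((\<lambda>s. Q s i t) has_vector_derivative cross3 (\<xi> i t) (q i t)) (at 0) \<and>
          \<xi> i t \<bullet> q i t = 0)) \<and>
    (\<forall>t\<in>{t0, tf}. \<delta>x t = 0 \<and> \<eta> t = 0 \<and> (\<forall>i\<in>{1..n}. \<xi> i t = 0))"

definition lagrange_dalembert ::
    "quadrotor \<Rightarrow> real \<Rightarrow> real \<Rightarrow> (real \<Rightarrow> real) \<Rightarrow> (real \<Rightarrow> real^3) \<Rightarrow>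
      (real \<Rightarrow> real^3) \<Rightarrow> (real \<Rightarrow> real^3^3) \<Rightarrow> (nat \<Rightarrow> real \<Rightarrow> real^3) \<Rightarrow> bool"
  where "lagrange_dalembert P t0 tf f M x R q \<longleftrightarrow>
    (\<forall>e X A Q \<delta>x \<eta> \<xi>. variation (num_links P) t0 tf x R q e X A Q \<delta>x \<eta> \<xi> \<longrightarrow>
      (\<exists>D. ((\<lambda>s. action P t0 tf (X s) (A s) (Q s)) has_real_derivative D) (at 0) \<and>
           D + integral {t0..tf} (\<lambda>t. (- f t *\<^sub>R (R t *v e3)) \<bullet> \<delta>x t + M t \<bullet> \<eta> t) = 0))"

text \<open>The equations of motion below are stated at one instant. Their arguments are values:
  \<open>xdd\<close>, \<open>qd\<close>, \<open>qdd\<close>, \<open>\<Omega>d\<close>, \<open>\<omega>d\<close> stand for the (second) time derivatives of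
  \<open>x\<close>, \<open>q\<close>, \<open>\<Omega>\<close>, \<open>\<omega>\<close>.\<close>

definition position_equation ::
    "quadrotor \<Rightarrow> real \<Rightarrow> real^3^3 \<Rightarrow> real^3 \<Rightarrow> (nat \<Rightarrow> real^3) \<Rightarrow> bool"
  where "position_equation P f R xdd qdd \<longleftrightarrow>
    inertia_const P 0 0 *\<^sub>R xdd + (\<Sum>i=1..num_links P. inertia_const P 0 i *\<^sub>R qdd i)
    = - f *\<^sub>R (R *v e3) + (inertia_const P 0 0 * gravity P) *\<^sub>R e3"

definition link_equation ::
    "quadrotor \<Rightarrow> real^3 \<Rightarrow> (nat \<Rightarrow> real^3) \<Rightarrow> (nat \<Rightarrow> real^3) \<Rightarrow> (nat \<Rightarrow> real^3) \<Rightarrow> nat \<Rightarrow> bool"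
  where "link_equation P xdd q qd qdd i \<longleftrightarrow>
    inertia_const P i i *\<^sub>R qdd i
    - (hat (q i) ** hat (q i)) *v
        (inertia_const P i 0 *\<^sub>R xdd + (\<Sum>j\<in>{1..num_links P} - {i}. inertia_const P i j *\<^sub>R qdd j))
    = - (inertia_const P i i * (norm (qd i))\<^sup>2) *\<^sub>R q i
      - (\<Sum>a=i..num_links P. link_mass P a * gravity P * link_length P i) *\<^sub>R
          ((hat (q i) ** hat (q i)) *v e3)"

definition attitude_equation :: "quadrotor \<Rightarrow> real^3 \<Rightarrow> real^3 \<Rightarrow> real^3 \<Rightarrow> bool"
  where "attitude_equation P M \<Omega> \<Omega>d \<longleftrightarrow>
    body_inertia P *v \<Omega>d + hat \<Omega> *v (body_inertia P *v \<Omega>) = M"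

text \<open>Block matrices and block vectors have block indices \<open>0, \<dots>, n\<close>; the blocks are of size
  \<open>3 \<times> 3\<close> and \<open>3\<close>, respectively.\<close>

definition block_mult_vec :: "nat \<Rightarrow> (nat \<Rightarrow> nat \<Rightarrow> real^3^3) \<Rightarrow> (nat \<Rightarrow> real^3) \<Rightarrow> nat \<Rightarrow> real^3"
  where "block_mult_vec n A v i = (\<Sum>j=0..n. A i j *v v j)"

definition block_vec :: "real^3 \<Rightarrow> (nat \<Rightarrow> real^3) \<Rightarrow> nat \<Rightarrow> real^3"
  where "block_vec v w j = (if j = 0 then v else w j)"

definition direction_matrix :: "quadrotor \<Rightarrow> (nat \<Rightarrow> real^3) \<Rightarrow> nat \<Rightarrow> nat \<Rightarrow> real^3^3"
  where "direction_matrix P q i j =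
    (if i = 0 \<or> i = j then inertia_const P i j *\<^sub>R mat 1
     else - inertia_const P i j *\<^sub>R (hat (q i) ** hat (q i)))"

definition direction_rhs ::
    "quadrotor \<Rightarrow> real \<Rightarrow> real^3^3 \<Rightarrow> (nat \<Rightarrow> real^3) \<Rightarrow> (nat \<Rightarrow> real^3) \<Rightarrow> nat \<Rightarrow> real^3"
  where "direction_rhs P f R q qd i =
    (if i = 0 then - f *\<^sub>R (R *v e3) + (inertia_const P 0 0 * gravity P) *\<^sub>R e3
     else - ((norm (qd i))\<^sup>2 * inertia_const P i i) *\<^sub>R q i
          - (\<Sum>a=i..num_links P. link_mass P a * gravity P * link_length P i) *\<^sub>R
              ((hat (q i) ** hat (q i)) *v e3))"

definition direction_matrix_equation ::
    "quadrotor \<Rightarrow> real \<Rightarrow> real^3^3 \<Rightarrow> real^3 \<Rightarrow> (nat \<Rightarrow> real^3) \<Rightarrow> (nat \<Rightarrow> real^3) \<Rightarrow> (nat \<Rightarrow> real^3) \<Rightarrow> bool"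
  where "direction_matrix_equation P f R xdd q qd qdd \<longleftrightarrow>
    (\<forall>i\<in>{0..num_links P}. block_mult_vec (num_links P) (direction_matrix P q) (block_vec xdd qdd) i
       = direction_rhs P f R q qd i)"

definition velocity_matrix :: "quadrotor \<Rightarrow> (nat \<Rightarrow> real^3) \<Rightarrow> nat \<Rightarrow> nat \<Rightarrow> real^3^3"
  where "velocity_matrix P q i j =
    (if i = j then inertia_const P i j *\<^sub>R mat 1
     else if i = 0 then - inertia_const P 0 j *\<^sub>R hat (q j)
     else if j = 0 then inertia_const P i 0 *\<^sub>R hat (q i)
     else - inertia_const P i j *\<^sub>R (hat (q i) ** hat (q j)))"

definition velocity_rhs ::
    "quadrotor \<Rightarrow> real \<Rightarrow> real^3^3 \<Rightarrow> (nat \<Rightarrow> real^3) \<Rightarrow> (nat \<Rightarrow> real^3) \<Rightarrow> nat \<Rightarrow> real^3"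
  where "velocity_rhs P f R q \<omega> i =
    (if i = 0 then (\<Sum>j=1..num_links P. (inertia_const P 0 j * (norm (\<omega> j))\<^sup>2) *\<^sub>R q j)
            - f *\<^sub>R (R *v e3) + (inertia_const P 0 0 * gravity P) *\<^sub>R e3
     else (\<Sum>j\<in>{1..num_links P} - {i}.
              (inertia_const P i j * (norm (\<omega> j))\<^sup>2) *\<^sub>R (hat (q i) *v q j))
          + (\<Sum>a=i..num_links P. link_mass P a * gravity P * link_length P i) *\<^sub>R (hat (q i) *v e3))"

definition velocity_matrix_equation ::
    "quadrotor \<Rightarrow> real \<Rightarrow> real^3^3 \<Rightarrow> real^3 \<Rightarrow> (nat \<Rightarrow> real^3) \<Rightarrow> (nat \<Rightarrow> real^3) \<Rightarrow> (nat \<Rightarrow> real^3) \<Rightarrow> bool"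
  where "velocity_matrix_equation P f R xdd q \<omega> \<omega>d \<longleftrightarrow>
    (\<forall>i\<in>{0..num_links P}. block_mult_vec (num_links P) (velocity_matrix P q) (block_vec xdd \<omega>d) i
       = velocity_rhs P f R q \<omega> i)"

definition link_angular_velocities ::
    "nat \<Rightarrow> real \<Rightarrow> real \<Rightarrow> (nat \<Rightarrow> real \<Rightarrow> real^3) \<Rightarrow> (nat \<Rightarrow> real \<Rightarrow> real^3) \<Rightarrow> (nat \<Rightarrow> real \<Rightarrow> real^3) \<Rightarrow> bool"
  where "link_angular_velocities n t0 tf q \<omega> \<omega>d \<longleftrightarrow>
    (\<forall>i\<in>{1..n}. \<forall>t\<in>{t0..tf}.
       q i t \<bullet> \<omega> i t = 0 \<and>
       (q i has_vector_derivative cross3 (\<omega> i t) (q i t)) (at t within {t0..tf}) \<and>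
       (\<omega> i has_vector_derivative \<omega>d i t) (at t within {t0..tf}))"

end

theory Submission
  imports Defs
begin

text \<open>Along a variation the action is differentiated under the integral sign, and integrating by
  parts in time turns its first variation, together with the virtual work of the inputs, into
  \<open>\<integral> E\<^sub>x \<bullet> \<delta>x + \<Sum>\<^sub>i E\<^sub>i \<bullet> (\<xi>\<^sub>i \<times> q\<^sub>i) + E\<^sub>R \<bullet> \<eta>\<close>, where the residuals \<open>E\<^sub>x\<close>, \<open>q\<^sub>i \<times> E\<^sub>i\<close>
  and \<open>E\<^sub>R\<close> vanish exactly when the equations of motion hold. The attitude enters through
  \<open>\<delta>\<Omega> = \<eta>' + \<Omega> \<times> \<eta>\<close>. Conversely, translating the position along a coordinate axis, and rotating the
  attitude and the links about it by an angle \<open>s \<phi>(t)\<close>, with a bump function \<open>\<phi>\<close>, are admissible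
  variations, so the fundamental lemma of the calculus of variations isolates the components of
  the residuals. The matrix forms follow from \<open>q \<times> (q \<times> y) = (q \<bullet> y) q - y\<close> for unit \<open>q\<close> and, for the
  last one, \<open>q'' = \<omega>' \<times> q - |\<omega>|\<^sup>2 q\<close>.\<close>

section \<open>The hat map and rotations\<close>

lemma bounded_bilinear_cross3: "bounded_bilinear cross3"
  using bilinear_cross by (simp add: bilinear_conv_bounded_bilinear)

lemmas has_vector_derivative_cross3 [derivative_intros] =
  bounded_bilinear.has_vector_derivative [OF bounded_bilinear_cross3]

lemmas has_vector_derivative_inner [derivative_intros] =
  bounded_bilinear.has_vector_derivative [OF bounded_bilinear_inner]

lemmas has_vector_derivative_matrix_vector_mult [derivative_intros] =
  bounded_linear.has_vector_derivative [OF matrix_vector_mul_bounded_linear]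

lemma bounded_bilinear_matrix_matrix_mult:
  "bounded_bilinear ((**) :: real^'n^'m \<Rightarrow> real^'p^'n \<Rightarrow> real^'p^'m)"
  unfolding bilinear_conv_bounded_bilinear [symmetric] bilinear_def
  by (auto intro!: linearI simp: vec_eq_iff matrix_matrix_mult_def sum.distrib algebra_simps
      sum_distrib_left)

lemma bounded_bilinear_matrix_vector_mult:
  "bounded_bilinear ((*v) :: real^'n^'m \<Rightarrow> real^'n \<Rightarrow> real^'m)"
  unfolding bilinear_conv_bounded_bilinear [symmetric] bilinear_def
  by (auto intro!: linearI simp: vec_eq_iff matrix_vector_mult_def sum.distrib algebra_simps
      sum_distrib_left)

lemma hat_components:
  "hat v $ 1 $ 1 = 0" "hat v $ 1 $ 2 = - v $ 3" "hat v $ 1 $ 3 = v $ 2"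
  "hat v $ 2 $ 1 = v $ 3" "hat v $ 2 $ 2 = 0" "hat v $ 2 $ 3 = - v $ 1"
  "hat v $ 3 $ 1 = - v $ 2" "hat v $ 3 $ 2 = v $ 1" "hat v $ 3 $ 3 = 0"
  by (simp_all add: hat_def matrix_def cross3_def axis_def)

lemma linear_hat: "linear hat"
  by (rule linearI; simp add: vec_eq_iff forall_3 hat_components)

lemma bounded_linear_hat: "bounded_linear hat"
  using linear_hat by (rule linear_conv_bounded_linear [THEN iffD1])

lemmas hat_scaleR = linear_scale [OF linear_hat]

text \<open>Reads off three entries of any matrix, which keeps it linear on the whole matrix space;
  it inverts \<open>hat\<close> only on skew matrices, see \<open>hat_vee\<close>.\<close>

definition vee :: "real^3^3 \<Rightarrow> real^3"
  where "vee B = vector [B $ 3 $ 2, B $ 1 $ 3, B $ 2 $ 1]"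

lemma vee_hat [simp]: "vee (hat v) = v"
  by (simp add: vee_def vec_eq_iff forall_3 hat_components)

lemma linear_vee: "linear vee"
  by (rule linearI; simp add: vee_def vec_eq_iff forall_3)

lemma hat_vee:
  assumes "transpose B = - B"
  shows "hat (vee B) = B"
proof -
  have "B $ i $ j = - B $ j $ i" for i j
    using arg_cong [OF assms, of "\<lambda>C. C $ j $ i"] by (simp add: transpose_def)
  note skew = this
  have "B $ i $ i = 0" for i
    using skew [of i i] by simp
  then show ?thesis
    using skew [of 1 2] skew [of 1 3] skew [of 2 3]
    by (simp add: vec_eq_iff forall_3 hat_components vee_def)
qed

lemma bounded_linear_transpose: "bounded_linear (transpose :: real^'n^'m \<Rightarrow> real^'m^'n)"
  unfolding linear_conv_bounded_linear [symmetric]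
  by (rule linearI) (simp_all add: transpose_def vec_eq_iff)

text \<open>For a curve \<open>A\<close> of rotations with derivative \<open>B\<close>, the
  expression \<open>vee (transpose A ** B)\<close> is its body angular velocity. Bilinearity makes
  the product rule and continuity available for angular velocities and for the variation
  \<open>\<eta>\<close>.\<close>

lemma bounded_bilinear_vee: "bounded_bilinear (\<lambda>(A :: real^3^3) B. vee (transpose A ** B))"
proof -
  interpret m: bounded_bilinear "(**) :: real^3^3 \<Rightarrow> real^3^3 \<Rightarrow> real^3^3"
    by (rule bounded_bilinear_matrix_matrix_mult)
  have "linear (\<lambda>B. vee (transpose A ** B))" for A :: "real^3^3"
    using linear_compose [OF bounded_linear.linear [OF m.bounded_linear_right] linear_vee]
    by (simp add: o_def)
  moreover have "linear (\<lambda>A. vee (transpose A ** B))" for B :: "real^3^3"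
    using linear_compose [OF bounded_linear.linear [OF bounded_linear_transpose]
        linear_compose [OF bounded_linear.linear [OF m.bounded_linear_left] linear_vee]]
    by (simp add: o_def)
  ultimately show ?thesis
    unfolding bilinear_conv_bounded_bilinear [symmetric] bilinear_def by blast
qed

text \<open>Rotations preserve cross products. This converts a rotation about the inertial axis
  \<open>c\<close> into the body-fixed form \<open>R ** hat \<eta>\<close> that variations of the
  attitude must have.\<close>

lemma hat_matrix_mult_rotation:
  assumes "rotation_matrix A"
  shows "hat c ** A = A ** hat (transpose A *v c)"
proof -
  have "cross3 c (A *v y) = A *v cross3 (transpose A *v c) y" for y
  proof -
    have "A *v (transpose A *v c) = c"
      using assms by (simp only: matrix_vector_mul_assoc rotation_matrix_def orthogonal_matrix_def
          matrix_vector_mul_lid)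
    then show ?thesis
      using cross_rotation_matrix [OF assms, of "transpose A *v c" y] by simp
  qed
  then show ?thesis
    by (simp add: matrix_eq matrix_vector_mul_assoc [symmetric] hat_mult_vec)
qed

text \<open>The Jacobi identity in matrix form: \<open>hat\<close> turns the cross product into the
  commutator. It is the source of the term \<Omega> \<times> \<eta> in the variation of the angular
  velocity.\<close>

lemma hat_cross: "hat (cross3 u v) = hat u ** hat v - hat v ** hat u"
  by (simp add: vec_eq_iff forall_3 hat_components matrix_matrix_mult_def sum_3 cross3_def)

text \<open>Differentiating \<open>transpose A ** A = mat 1\<close> shows that \<open>transpose A ** A'\<close> is skew.\<close>

lemma rotation_derivative:
  assumes "a < b" "t \<in> {a..b}" "\<And>t. t \<in> {a..b} \<Longrightarrow> rotation_matrix (A t)"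
    and A: "(A has_vector_derivative A') (at t within {a..b})"
  shows "A' = A t ** hat (vee (transpose (A t) ** A'))"
proof -
  interpret m: bounded_bilinear "(**) :: real^3^3 \<Rightarrow> real^3^3 \<Rightarrow> real^3^3"
    by (rule bounded_bilinear_matrix_matrix_mult)
  have orth: "transpose (A s) ** A s = mat 1" "A s ** transpose (A s) = mat 1" if "s \<in> {a..b}" for s
    using assms(3) [OF that] by (auto simp: rotation_matrix_def orthogonal_matrix_def)
  have "((\<lambda>s. transpose (A s) ** A s) has_vector_derivative
      transpose (A t) ** A' + transpose A' ** A t) (at t within {a..b})"
    by (intro m.has_vector_derivative A
        bounded_linear.has_vector_derivative [OF bounded_linear_transpose])
  moreover have "((\<lambda>s. transpose (A s) ** A s) has_vector_derivative 0) (at t within {a..b})"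
    by (rule has_vector_derivative_transform [OF assms(2) _ has_vector_derivative_const])
      (use orth in auto)
  ultimately have sum: "transpose (A t) ** A' + transpose A' ** A t = 0"
    by (rule vector_derivative_unique_within_closed_interval [OF assms(1), unfolded box_real, OF assms(2)])
  have "transpose (transpose (A t) ** A') = transpose A' ** A t"
    by (simp add: matrix_transpose_mul)
  also have "\<dots> = - (transpose (A t) ** A')"
    using sum by (metis eq_neg_iff_add_eq_0 add.commute)
  finally have "hat (vee (transpose (A t) ** A')) = transpose (A t) ** A'"
    by (rule hat_vee)
  then have "A t ** hat (vee (transpose (A t) ** A')) = A t ** (transpose (A t) ** A')"
    by (rule arg_cong)
  also have "\<dots> = A'"
    by (simp only: matrix_mul_assoc orth(2) [OF assms(2)] matrix_mul_lid)
  finally show ?thesis ..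
qed

lemma continuous_on_matrix_vector_mult [continuous_intros]:
  fixes A :: "'a::topological_space \<Rightarrow> real^'n^'m"
  assumes "continuous_on S A" "continuous_on S v"
  shows "continuous_on S (\<lambda>t. A t *v v t)"
  using assms by (rule bounded_bilinear.continuous_on [OF bounded_bilinear_matrix_vector_mult])

section \<open>Rotations about a coordinate axis, by Rodrigues' formula\<close>

definition axis_rotation :: "3 \<Rightarrow> real \<Rightarrow> real^3^3"
  where "axis_rotation k \<theta> = mat 1 + sin \<theta> *\<^sub>R hat (axis k 1)
    + (1 - cos \<theta>) *\<^sub>R (hat (axis k 1) ** hat (axis k 1))"

lemma rotation_matrix_axis_rotation: "rotation_matrix (axis_rotation k \<theta>)"
proof -
  define s c where "s = sin \<theta>" and "c = cos \<theta>"
  \<comment> \<open>Used as a rewrite rule, this eliminates the squares of the sine, so that every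
    matrix entry and the determinant become polynomial identities.\<close>
  have sc: "s * s = 1 - c * c"
    using sin_cos_squared_add3 [of \<theta>] unfolding s_def c_def by linarith
  have "transpose (axis_rotation k \<theta>) ** axis_rotation k \<theta> = mat 1 \<and> det (axis_rotation k \<theta>) = 1"
    unfolding axis_rotation_def s_def [symmetric] c_def [symmetric]
    using exhaust_3 [of k] sc
    by (elim disjE) (simp_all add: vec_eq_iff forall_3 matrix_matrix_mult_def sum_3 transpose_def
        mat_def hat_components axis_def det_3 algebra_simps)
  then show ?thesis
    by (simp add: rotation_matrix_def orthogonal_matrix)
qed

lemma rotation_matrix_mult:
  fixes A B :: "real^'n^'n"
  shows "rotation_matrix A \<Longrightarrow> rotation_matrix B \<Longrightarrow> rotation_matrix (A ** B)"
  by (simp add: rotation_matrix_def orthogonal_matrix_mul det_mul)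

lemma norm_rotation_matrix:
  fixes A :: "real^'n^'n"
  shows "rotation_matrix A \<Longrightarrow> norm (A *v v) = norm v"
  using orthogonal_transformation_matrix [of "(*v) A"]
  by (auto simp: rotation_matrix_def orthogonal_transformation)

section \<open>Differentiable families of curves\<close>

lemma C1_familyD:
  assumes "C1_family e a b F Fs Ft"
  shows "\<And>s t. s \<in> {-e<..<e} \<Longrightarrow> t \<in> {a..b} \<Longrightarrow> ((\<lambda>s. F s t) has_vector_derivative Fs s t) (at s)"
    and "\<And>s t. s \<in> {-e<..<e} \<Longrightarrow> t \<in> {a..b} \<Longrightarrow> (F s has_vector_derivative Ft s t) (at t within {a..b})"
    and "continuous_on ({-e<..<e} \<times> {a..b}) (\<lambda>(s, t). Fs s t)"
    and "continuous_on ({-e<..<e} \<times> {a..b}) (\<lambda>(s, t). Ft s t)"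
  using assms unfolding C1_family_def by (blast, blast, simp_all only:)

lemma C1_familyI:
  assumes "\<And>s t. s \<in> {-e<..<e} \<Longrightarrow> t \<in> {a..b} \<Longrightarrow> ((\<lambda>s. F s t) has_vector_derivative Fs s t) (at s)"
    and "\<And>s t. s \<in> {-e<..<e} \<Longrightarrow> t \<in> {a..b} \<Longrightarrow>
      (F s has_vector_derivative Ft s t) (at t within {a..b})"
    and "continuous_on ({-e<..<e} \<times> {a..b}) (\<lambda>z. Fs (fst z) (snd z))"
    and "continuous_on ({-e<..<e} \<times> {a..b}) (\<lambda>z. Ft (fst z) (snd z))"
  shows "C1_family e a b F Fs Ft"
  using assms unfolding C1_family_def split_beta by blast

text \<open>\<open>C1_family\<close> asks for joint continuity of the partial derivatives only.
  Existence of the partial derivative in \<open>s\<close> together with continuity of the one in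
  \<open>t\<close> gives total differentiability, hence joint continuity of the family
  itself.\<close>

lemma C1_family_continuous:
  assumes F: "C1_family e a b F Fs Ft"
  shows "continuous_on ({-e<..<e} \<times> {a..b}) (\<lambda>(s, t). F s t)"
proof (unfold continuous_on_eq_continuous_within, rule ballI)
  fix z assume "z \<in> {-e<..<e} \<times> {a..b}"
  then obtain s t where z: "z = (s, t)" "s \<in> {-e<..<e}" "t \<in> {a..b}"
    by auto
  have "((\<lambda>(s, t). F s t) has_derivative
      (\<lambda>(ds, dt). ds *\<^sub>R Fs s t + blinfun_scaleR_left (Ft s t) dt))
      (at (s, t) within {-e<..<e} \<times> {a..b})"
  proof (rule has_derivative_partialsI)
    show "((\<lambda>s. F s t) has_derivative (\<lambda>ds. ds *\<^sub>R Fs s t)) (at s within {-e<..<e})"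
      using C1_familyD(1) [OF F z(2,3)]
      by (simp add: has_vector_derivative_def has_derivative_at_withinI)
    show "(F s has_derivative blinfun_apply (blinfun_scaleR_left (Ft s t))) (at t within {a..b})"
      if "s \<in> {-e<..<e}" "t \<in> {a..b}" for s t
      using C1_familyD(2) [OF F that]
      by (simp add: has_vector_derivative_eq_has_derivative_blinfun)
    \<comment> \<open>The criterion for total differentiability wants the partial derivative as a
      continuous map into bounded linear operators, so the vector \<open>Ft s t\<close> is turned
      into the operator that scales it.\<close>
    have "continuous_on ({-e<..<e} \<times> {a..b}) (\<lambda>(s, t). blinfun_scaleR_left (Ft s t))"
      using C1_familyD(4) [OF F] by (auto simp: split_beta intro!: continuous_intros)
    then show "continuous (at (s, t) within {-e<..<e} \<times> {a..b})
        (\<lambda>(s, t). blinfun_scaleR_left (Ft s t))"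
      using z by (auto simp: continuous_on_eq_continuous_within)
  qed (use z in auto)
  then show "continuous (at z within {-e<..<e} \<times> {a..b}) (\<lambda>(s, t). F s t)"
    using has_derivative_continuous z(1) by blast
qed

lemma continuous_on_slice:
  assumes "continuous_on (S \<times> T) (\<lambda>(s, t). F s t)" "s \<in> S"
  shows "continuous_on T (F s)"
proof -
  have "continuous_on T (\<lambda>t. (s, t))"
    by (intro continuous_intros)
  from continuous_on_compose2 [OF assms(1) this] show ?thesis
    using assms(2) by auto
qed

text \<open>Integrating \<open>Fts\<close> in time and differentiating under the integral sign recovers the increments
  of \<open>Fs\<close>, so Schwarz's theorem is not needed.\<close>

lemma C1_family_mixed_partial:
  fixes F :: "real \<Rightarrow> real \<Rightarrow> 'a::banach"
  assumes F: "C1_family e a b F Fs Ft" and Ft: "C1_family e a b Ft Fts Ftt"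
    and s: "s \<in> {-e<..<e}" and t: "t \<in> {a..b}"
  shows "(Fs s has_vector_derivative Fts s t) (at t within {a..b})"
proof -
  have *: "integral {a..u} (Fts s) = Fs s u - Fs s a" if u: "u \<in> {a..b}" for u
  proof -
    have sub: "{a..u} \<subseteq> {a..b}"
      using u by auto
    have int: "(Ft r has_integral F r u - F r a) {a..u}" if "r \<in> {-e<..<e}" for r
      by (rule fundamental_theorem_of_calculus)
        (use that u in \<open>auto intro: has_vector_derivative_within_subset [OF C1_familyD(2) [OF F]]\<close>)
    have "((\<lambda>r. integral (cbox a u) (Ft r)) has_vector_derivative integral (cbox a u) (Fts s))
        (at s within {-e<..<e})"
    proof (rule leibniz_rule_vector_derivative)
      show "continuous_on ({-e<..<e} \<times> cbox a u) (\<lambda>(s, t). Fts s t)"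
        by (rule continuous_on_subset [OF C1_familyD(3) [OF Ft]]) (use sub in auto)
      show "((\<lambda>r. Ft r t) has_vector_derivative Fts r t) (at r within {-e<..<e})"
        if "r \<in> {-e<..<e}" "t \<in> cbox a u" for r t
        using that sub by (auto intro: has_vector_derivative_at_within [OF C1_familyD(1) [OF Ft]])
    qed (use int s in auto)
    from this [unfolded box_real] have "((\<lambda>r. F r u - F r a) has_vector_derivative integral {a..u} (Fts s))
        (at s within {-e<..<e})"
      by (rule has_vector_derivative_transform [OF s, rotated])
        (rule integral_unique [OF int, symmetric])
    then have "((\<lambda>r. F r u - F r a) has_vector_derivative integral {a..u} (Fts s)) (at s)"
      using s by (simp add: has_vector_derivative_within_open [of s "{-e<..<e}"])
    moreover have "((\<lambda>r. F r u - F r a) has_vector_derivative Fs s u - Fs s a) (at s)"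
      using s u t by (intro has_vector_derivative_diff C1_familyD(1) [OF F]) auto
    ultimately show ?thesis
      by (rule vector_derivative_unique_at)
  qed
  have "((\<lambda>u. Fs s a + integral {a..u} (Fts s)) has_vector_derivative 0 + Fts s t)
      (at t within {a..b})"
    by (intro has_vector_derivative_add has_vector_derivative_const
        integral_has_vector_derivative t continuous_on_slice [OF C1_familyD(3) [OF Ft] s])
  then show ?thesis
    by (rule has_vector_derivative_transform [OF t, rotated, THEN has_vector_derivative_eq_rhs])
      (use * in auto)
qed

lemma C1_family_add:
  assumes "C1_family e a b F Fs Ft" "C1_family e a b G Gs Gt"
  shows "C1_family e a b (\<lambda>s t. F s t + G s t) (\<lambda>s t. Fs s t + Gs s t) (\<lambda>s t. Ft s t + Gt s t)"
  using assms unfolding C1_family_def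
  by (auto simp: split_beta intro!: has_vector_derivative_add continuous_on_add)

lemma C2_family_add:
  assumes "C2_family e a b F" "C2_family e a b G"
  shows "C2_family e a b (\<lambda>s t. F s t + G s t)"
  using assms unfolding C2_family_def
  by (elim exE conjE, intro exI conjI) (erule (1) C1_family_add)+

section \<open>C2 curves and the C2 families built from them\<close>

definition C2_curve :: "real \<Rightarrow> real \<Rightarrow> (real \<Rightarrow> 'a::real_normed_vector) \<Rightarrow> bool"
  where "C2_curve a b u \<longleftrightarrow> (\<exists>u' u''.
    (\<forall>t\<in>{a..b}. (u has_vector_derivative u' t) (at t within {a..b}) \<and>
       (u' has_vector_derivative u'' t) (at t within {a..b})) \<and>
    continuous_on {a..b} u'')"

lemma C2_curve_bounded_linear:
  assumes "bounded_linear g" "C2_curve a b u"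
  shows "C2_curve a b (\<lambda>t. g (u t))"
proof -
  interpret g: bounded_linear g by fact
  obtain u' u'' where
    "\<And>t. t \<in> {a..b} \<Longrightarrow> (u has_vector_derivative u' t) (at t within {a..b})"
    "\<And>t. t \<in> {a..b} \<Longrightarrow> (u' has_vector_derivative u'' t) (at t within {a..b})"
    "continuous_on {a..b} u''"
    using assms(2) unfolding C2_curve_def by blast
  then show ?thesis
    unfolding C2_curve_def
    by (intro exI [of _ "\<lambda>t. g (u' t)"] exI [of _ "\<lambda>t. g (u'' t)"])
      (auto intro!: g.has_vector_derivative g.continuous_on)
qed

lemma C1_family_scaleR:
  assumes F: "C1_family e a b F Fs Ft" and G: "C1_family e a b G Gs Gt"
  shows "C1_family e a b (\<lambda>s t. F s t *\<^sub>R G s t) (\<lambda>s t. F s t *\<^sub>R Gs s t + Fs s t *\<^sub>R G s t)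
    (\<lambda>s t. F s t *\<^sub>R Gt s t + Ft s t *\<^sub>R G s t)"
proof -
  have "((\<lambda>s. F s t *\<^sub>R G s t) has_vector_derivative F s t *\<^sub>R Gs s t + Fs s t *\<^sub>R G s t) (at s)"
    "((\<lambda>t. F s t *\<^sub>R G s t) has_vector_derivative F s t *\<^sub>R Gt s t + Ft s t *\<^sub>R G s t) (at t within {a..b})"
    if "s \<in> {-e<..<e}" "t \<in> {a..b}" for s t
    using C1_familyD(1,2) [OF F that] C1_familyD(1,2) [OF G that]
    by - (rule bounded_bilinear.has_vector_derivative [OF bounded_bilinear_scaleR]; assumption)+
  note D = this
  note cont = C1_familyD(3,4) [OF F] C1_familyD(3,4) [OF G] C1_family_continuous [OF F]
    C1_family_continuous [OF G]
  show ?thesis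
    by (rule C1_familyI) (intro D continuous_on_add continuous_on_scaleR cont [unfolded split_beta];
      assumption)+
qed

lemma C1_family_time:
  assumes "\<And>t. t \<in> {a..b} \<Longrightarrow> (u has_vector_derivative u' t) (at t within {a..b})"
    and "continuous_on {a..b} u'"
  shows "C1_family e a b (\<lambda>s t. u t) (\<lambda>s t. 0) (\<lambda>s t. u' t)"
  by (rule C1_familyI)
    (auto intro!: assms continuous_on_compose2 [OF assms(2)] continuous_intros)

lemma C1_family_parameter: "C1_family e a b (\<lambda>s t. s) (\<lambda>s t. 1 :: real) (\<lambda>s t. 0)"
  by (rule C1_familyI) auto

lemma C1_family_compose:
  fixes H H' :: "real \<Rightarrow> real"
  assumes H: "\<And>y. (H has_real_derivative H' y) (at y)" "continuous_on UNIV H'"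
    and F: "C1_family e a b F Fs Ft"
  shows "C1_family e a b (\<lambda>s t. H (F s t)) (\<lambda>s t. H' (F s t) *\<^sub>R Fs s t) (\<lambda>s t. H' (F s t) *\<^sub>R Ft s t)"
proof -
  have "((\<lambda>s. H (F s t)) has_vector_derivative H' (F s t) *\<^sub>R Fs s t) (at s)"
    "((\<lambda>t. H (F s t)) has_vector_derivative H' (F s t) *\<^sub>R Ft s t) (at t within {a..b})"
    if "s \<in> {-e<..<e}" "t \<in> {a..b}" for s t
    using C1_familyD(1,2) [OF F that] DERIV_chain2 [OF H(1)]
    unfolding has_real_derivative_iff_has_vector_derivative [symmetric] real_scaleR_def by blast+
  note D = this
  have "continuous_on ({-e<..<e} \<times> {a..b}) (\<lambda>z. H' (F (fst z) (snd z)))"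
    using C1_family_continuous [OF F]
    by (intro continuous_on_compose2 [OF H(2)]) (auto simp: split_beta)
  note cont = this C1_familyD(3,4) [OF F, unfolded split_beta]
  show ?thesis
    by (rule C1_familyI) (rule D continuous_on_scaleR [OF cont(1,2)] continuous_on_scaleR [OF cont(1,3)];
      assumption?)+
qed

text \<open>All test variations are sums of terms of this shape: translations use the identity for
  \<open>G\<close>, rotations use 1, a sine and 1 minus a cosine. The product and chain rules are
  applied twice.\<close>

lemma C2_family_scaleR:
  fixes G G' G'' :: "real \<Rightarrow> real"
  assumes G: "\<And>y. (G has_real_derivative G' y) (at y)" "\<And>y. (G' has_real_derivative G'' y) (at y)"
      "continuous_on UNIV G''"
    and \<phi>: "C2_curve a b \<phi>" and u: "C2_curve a b u"
  shows "C2_family e a b (\<lambda>s t. G (s * \<phi> t) *\<^sub>R u t)"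
proof -
  obtain \<phi>' \<phi>'' where \<phi>:
    "\<And>t. t \<in> {a..b} \<Longrightarrow> (\<phi> has_vector_derivative \<phi>' t) (at t within {a..b})"
    "\<And>t. t \<in> {a..b} \<Longrightarrow> (\<phi>' has_vector_derivative \<phi>'' t) (at t within {a..b})"
    "continuous_on {a..b} \<phi>''"
    using \<phi> unfolding C2_curve_def by blast
  obtain u' u'' where u:
    "\<And>t. t \<in> {a..b} \<Longrightarrow> (u has_vector_derivative u' t) (at t within {a..b})"
    "\<And>t. t \<in> {a..b} \<Longrightarrow> (u' has_vector_derivative u'' t) (at t within {a..b})"
    "continuous_on {a..b} u''"
    using u unfolding C2_curve_def by blast
  have cont: "continuous_on {a..b} \<phi>'" "continuous_on {a..b} u'" "continuous_on UNIV G'"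
    using continuous_on_vector_derivative [OF \<phi>(2)] continuous_on_vector_derivative [OF u(2)]
      DERIV_isCont [OF G(2)] by (simp_all add: continuous_on_eq_continuous_at)
  note \<phi>_time = C1_family_time [where e = e, OF \<phi>(1) cont(1)]
    and \<phi>'_time = C1_family_time [where e = e, OF \<phi>(2,3)]
    and u_time = C1_family_time [where e = e, OF u(1) cont(2)]
    and u'_time = C1_family_time [where e = e, OF u(2,3)]
  \<comment> \<open>The product rule states its partial derivatives with their trivial factors 0 and
    1 left in place. The second-order families are built for exactly these unsimplified terms, and
    \<open>const\<close> supplies those factors.\<close>
  have const: "C1_family e a b (\<lambda>s t. c) (\<lambda>s t. 0) (\<lambda>s t. 0)" for c :: "'b::real_normed_vector"
    by (rule C1_family_time) auto
  note parameter = C1_family_parameter [of e a b]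
  note arg = C1_family_scaleR [OF parameter \<phi>_time]
  note G_arg = C1_family_compose [OF G(1) cont(3) arg] and G'_arg = C1_family_compose [OF G(2,3) arg]
  note arg_s = C1_family_add [OF C1_family_scaleR [OF parameter const] C1_family_scaleR [OF const \<phi>_time]]
    and arg_t = C1_family_add [OF C1_family_scaleR [OF parameter \<phi>'_time] C1_family_scaleR [OF const \<phi>_time]]
  show ?thesis
    unfolding C2_family_def real_scaleR_def [symmetric]
    using C1_family_scaleR [OF G_arg u_time]
      C1_family_add [OF C1_family_scaleR [OF G_arg const]
        C1_family_scaleR [OF C1_family_scaleR [OF G'_arg arg_s] u_time]]
      C1_family_add [OF C1_family_scaleR [OF G_arg u'_time]
        C1_family_scaleR [OF C1_family_scaleR [OF G'_arg arg_t] u_time]]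
    by (intro exI conjI)
qed

lemma axis_rotation_0 [simp]: "axis_rotation k 0 = mat 1"
  by (simp add: axis_rotation_def)

text \<open>At angle 0 the term with \<open>1 - cos\<close> is stationary, so only the infinitesimal
  generator \<open>hat (axis k 1)\<close> survives.\<close>

lemma axis_rotation_has_vector_derivative:
  "((\<lambda>s. axis_rotation k (c * s)) has_vector_derivative c *\<^sub>R hat (axis k 1)) (at 0)"
proof -
  have "((\<lambda>s. sin (c * s)) has_real_derivative c) (at 0)"
    "((\<lambda>s. 1 - cos (c * s)) has_real_derivative 0) (at 0)"
    by (auto intro!: derivative_eq_intros)
  from has_vector_derivative_add [OF has_vector_derivative_add [OF has_vector_derivative_const
        has_vector_derivative_scaleR [OF this(1) has_vector_derivative_const]]
      has_vector_derivative_scaleR [OF this(2) has_vector_derivative_const]]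
  show ?thesis
    unfolding axis_rotation_def by (rule has_vector_derivative_eq_rhs) simp
qed

text \<open>Rodrigues' formula splits the family into three terms of the form treated by
  \<open>C2_family_scaleR\<close>. The product \<open>pr\<close> stands for the matrix product in
  the case of the attitude and for the action on vectors in the case of a link.\<close>

lemma C2_family_axis_rotation:
  assumes "bounded_bilinear pr" and id: "\<And>v. pr (mat 1) v = v"
    and \<phi>: "C2_curve a b \<phi>" and u: "C2_curve a b u"
  shows "C2_family e a b (\<lambda>s t. pr (axis_rotation k (c * (s * \<phi> t))) (u t))"
proof -
  interpret pr: bounded_bilinear pr by fact
  let ?H = "hat (axis k 1)"
  have "C2_family e a b (\<lambda>s t. (\<lambda>_. 1) (s * \<phi> t) *\<^sub>R u t)"
    by (rule C2_family_scaleR [where G' = "\<lambda>_. 0" and G'' = "\<lambda>_. 0", OF _ _ _ \<phi> u]) auto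
  moreover have "C2_family e a b (\<lambda>s t. sin (c * (s * \<phi> t)) *\<^sub>R pr ?H (u t))"
    by (rule C2_family_scaleR [where G = "\<lambda>y. sin (c * y)" and G' = "\<lambda>y. c * cos (c * y)"
          and G'' = "\<lambda>y. - (c * c * sin (c * y))",
          OF _ _ _ \<phi> C2_curve_bounded_linear [OF pr.bounded_linear_right u]])
      (auto intro!: derivative_eq_intros continuous_intros)
  moreover have "C2_family e a b (\<lambda>s t. (1 - cos (c * (s * \<phi> t))) *\<^sub>R pr (?H ** ?H) (u t))"
    by (rule C2_family_scaleR [where G = "\<lambda>y. 1 - cos (c * y)" and G' = "\<lambda>y. c * sin (c * y)"
          and G'' = "\<lambda>y. c * c * cos (c * y)",
          OF _ _ _ \<phi> C2_curve_bounded_linear [OF pr.bounded_linear_right u]])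
      (auto intro!: derivative_eq_intros continuous_intros)
  ultimately show ?thesis
    using C2_family_add [OF C2_family_add]
    by (simp add: axis_rotation_def pr.add_left pr.scaleR_left id)
qed

lemma axis_rotation_apply_has_vector_derivative:
  assumes "bounded_bilinear pr"
  shows "((\<lambda>s. pr (axis_rotation k (c * (s * h))) u) has_vector_derivative
    (c * h) *\<^sub>R pr (hat (axis k 1)) u) (at 0)"
proof -
  interpret pr: bounded_bilinear pr by fact
  show ?thesis
    using bounded_linear.has_vector_derivative [OF pr.bounded_linear_left [of u]
        axis_rotation_has_vector_derivative [of k "c * h"]]
    by (simp add: pr.scaleR_left mult.assoc mult.commute [of h])
qed

section \<open>The fundamental lemma of the calculus of variations\<close>

text \<open>The only critical point is the kink at 0, where an exponent of at least 2 makes the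
  difference quotient tend to 0.\<close>

lemma has_real_derivative_positive_part_power:
  "((\<lambda>u :: real. max 0 u ^ Suc (Suc n)) has_real_derivative real (Suc (Suc n)) * max 0 u ^ Suc n) (at u)"
proof (cases u "0 :: real" rule: linorder_cases)
  case less
  then have "((\<lambda>u :: real. 0) has_real_derivative real (Suc (Suc n)) * max 0 u ^ Suc n) (at u)"
    by simp
  then show ?thesis
    by (rule has_field_derivative_transform_within_open [where S = "{..<0}"]) (use less in auto)
next
  case equal
  have "(\<lambda>h :: real. max 0 h ^ Suc n) \<midarrow>0\<rightarrow> max 0 0 ^ Suc n"
    by (intro tendsto_intros)
  then have "(\<lambda>h :: real. max 0 h ^ Suc (Suc n) / h) \<midarrow>0\<rightarrow> 0"
    \<comment> \<open>For nonzero \<open>h\<close> the quotient equals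
      \<open>max 0 h ^ Suc n\<close>.\<close>
    by (rule LIM_equal2 [where R = 1, rotated 2, THEN tendsto_eq_rhs]) (auto simp: max_def)
  then show ?thesis
    using equal by (simp add: DERIV_def)
next
  case greater
  have "((\<lambda>u. u ^ Suc (Suc n)) has_real_derivative real (Suc (Suc n)) * max 0 u ^ Suc n) (at u)"
    using DERIV_pow [of "Suc (Suc n)" u] greater by simp
  then show ?thesis
    by (rule has_field_derivative_transform_within_open [where S = "{0<..}"]) (use greater in auto)
qed

text \<open>For \<open>c < d\<close> this is positive exactly between \<open>c\<close> and
  \<open>d\<close>. With the exponent 3 the second derivative still carries a factor of the positive
  part, so it is continuous.\<close>

lemma C2_curve_bump: "C2_curve a b (\<lambda>t. max 0 ((t - c) * (d - t)) ^ 3)"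
proof -
  let ?p = "\<lambda>t. max 0 ((t - c) * (d - t))"
  have p: "((\<lambda>t. (t - c) * (d - t)) has_real_derivative c + d - 2 * t) (at t within {a..b})" for t
    by (auto intro!: derivative_eq_intros)
  have 3: "((\<lambda>t. ?p t ^ 3) has_real_derivative (3 * ?p t ^ 2) * (c + d - 2 * t)) (at t within {a..b})"
    for t
    using DERIV_chain2 [OF has_real_derivative_positive_part_power [of 1] p]
    by (simp add: numeral_3_eq_3 numeral_2_eq_2)
  have 2: "((\<lambda>t. ?p t ^ 2) has_real_derivative (2 * ?p t) * (c + d - 2 * t)) (at t within {a..b})"
    for t
    using DERIV_chain2 [OF has_real_derivative_positive_part_power [of 0] p]
    by (simp add: numeral_2_eq_2)
  have 4: "((\<lambda>t. (3 * ?p t ^ 2) * (c + d - 2 * t)) has_real_derivative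
      3 * ((2 * ?p t) * (c + d - 2 * t)) * (c + d - 2 * t) + (- 2) * (3 * ?p t ^ 2))
      (at t within {a..b})" for t
    by (intro DERIV_mult DERIV_cmult 2) (auto intro!: derivative_eq_intros)
  show ?thesis
    unfolding C2_curve_def has_real_derivative_iff_has_vector_derivative [symmetric]
    by (intro exI conjI ballI) (rule 3, rule 4, intro continuous_intros)
qed

text \<open>If \<open>h\<close> were positive at \<open>t\<close>, it would be positive on a small
  interval, and a bump supported there would give a positive integral. The negative case is
  symmetric.\<close>

lemma fundamental_lemma_calculus_of_variations:
  fixes h :: "real \<Rightarrow> real"
  assumes "a < b" and h: "continuous_on {a..b} h"
    and "\<And>\<phi>. C2_curve a b \<phi> \<Longrightarrow> \<phi> a = 0 \<Longrightarrow> \<phi> b = 0 \<Longrightarrow> integral {a..b} (\<lambda>t. \<phi> t * h t) = 0"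
    and t: "t \<in> {a..b}"
  shows "h t = 0"
proof -
  \<comment> \<open>Stated for every such function, because it is applied to both \<open>h\<close>
    and \<open>- h\<close>.\<close>
  have nonpos: "h t \<le> 0"
    if h: "continuous_on {a..b} h"
      and int: "\<And>\<phi>. C2_curve a b \<phi> \<Longrightarrow> \<phi> a = 0 \<Longrightarrow> \<phi> b = 0 \<Longrightarrow> integral {a..b} (\<lambda>t. \<phi> t * h t) = 0"
    for h :: "real \<Rightarrow> real"
  proof (rule ccontr)
    assume "\<not> h t \<le> 0"
    then have "h t > 0"
      by simp
    with h t obtain r where r: "r > 0" "\<And>s. s \<in> {a..b} \<Longrightarrow> dist s t < r \<Longrightarrow> dist (h s) (h t) < h t"
      unfolding continuous_on_iff by metis
    \<comment> \<open>Cutting off at \<open>a\<close> and \<open>b\<close> makes the bump vanish at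
      both end points, even if \<open>t\<close> is one of them.\<close>
    define c d where "c = max a (t - r)" and "d = min b (t + r)"
    have cd: "a \<le> c" "c < d" "d \<le> b" "t - r \<le> c" "d \<le> t + r"
      using t r(1) \<open>a < b\<close> by (auto simp: c_def d_def)
    have pos: "h s > 0" if "c < s" "s < d" for s
    proof -
      have "dist s t < r" "s \<in> {a..b}"
        using that cd by (auto simp: dist_real_def abs_less_iff)
      from r(2) [OF this(2,1)] show ?thesis
        by (simp add: dist_real_def abs_less_iff)
    qed
    define \<phi> where "\<phi> s = max 0 ((s - c) * (d - s)) ^ 3" for s
    have outside: "\<phi> s = 0" if "s \<le> c \<or> d \<le> s" for s
    proof -
      have "(s - c) * (d - s) \<le> 0"
        using that cd(2) by (auto simp: mult_le_0_iff)
      then show ?thesis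
        by (simp add: \<phi>_def max_def)
    qed
    have \<phi>: "C2_curve a b \<phi>"
      unfolding \<phi>_def by (rule C2_curve_bump)
    have cont: "continuous_on {a..b} (\<lambda>s. \<phi> s * h s)"
      unfolding \<phi>_def by (intro continuous_intros h)
    have "((\<lambda>s. \<phi> s * h s) has_integral 0) {a..b}"
      using integrable_integral [OF integrable_continuous_real [OF cont]] int [OF \<phi>] outside cd
      by simp
    moreover have "0 \<le> \<phi> s * h s" for s
      using pos [of s] outside [of s] by (cases "c < s \<and> s < d") (auto simp: \<phi>_def)
    \<comment> \<open>A continuous nonnegative function with integral 0 vanishes everywhere; the
      midpoint of the support contradicts this.\<close>
    ultimately have "\<phi> ((c + d) / 2) * h ((c + d) / 2) = 0"
      using has_integral_0_cbox_imp_0 [of a b "\<lambda>s. \<phi> s * h s" "(c + d) / 2"] cont cd by auto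
    moreover have "\<phi> ((c + d) / 2) > 0" "h ((c + d) / 2) > 0"
      using cd pos [of "(c + d) / 2"] by (auto simp: \<phi>_def max_def mult_le_0_iff)
    ultimately show False
      by simp
  qed
  have "h t \<le> 0"
    by (rule nonpos [OF h assms(3)])
  moreover have "- h t \<le> 0"
    using nonpos [of "\<lambda>t. - h t"] h assms(3) by (auto intro: continuous_intros)
  ultimately show ?thesis
    by simp
qed

section \<open>Equations at one instant\<close>

lemma cross_cross_unit:
  fixes u y :: "real^3"
  assumes "norm u = 1"
  shows "cross3 u (cross3 u y) = (u \<bullet> y) *\<^sub>R u - y"
  using assms by (simp add: Lagrange norm_eq_1)

text \<open>The vector \<open>cross3 u y\<close> is orthogonal to \<open>u\<close>, and on such
  vectors crossing twice with \<open>u\<close> is negation.\<close>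

lemma cross_cross_unit_eq_0_iff:
  fixes u y :: "real^3"
  assumes "norm u = 1"
  shows "cross3 u (cross3 u y) = 0 \<longleftrightarrow> cross3 u y = 0"
  using cross_cross_unit [OF assms, of "cross3 u y"] by (auto simp: dot_cross_self)

text \<open>This and \<open>link_momentum\<close> are the gradients of the kinetic energy in the
  velocities \<open>v\<close> and \<open>w i\<close>. Evaluated at accelerations, the same linear
  expressions are the rates of change of the momenta.\<close>

definition body_momentum :: "quadrotor \<Rightarrow> real^3 \<Rightarrow> (nat \<Rightarrow> real^3) \<Rightarrow> real^3"
  where "body_momentum P v w =
    inertia_const P 0 0 *\<^sub>R v + (\<Sum>i=1..num_links P. inertia_const P 0 i *\<^sub>R w i)"

definition link_momentum :: "quadrotor \<Rightarrow> real^3 \<Rightarrow> (nat \<Rightarrow> real^3) \<Rightarrow> nat \<Rightarrow> real^3"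
  where "link_momentum P v w i =
    inertia_const P i 0 *\<^sub>R v + (\<Sum>j=1..num_links P. inertia_const P i j *\<^sub>R w j)"

text \<open>The coefficient of \<open>e3 \<bullet> q i\<close> in minus the potential
  energy.\<close>

definition link_weight :: "quadrotor \<Rightarrow> nat \<Rightarrow> real"
  where "link_weight P i = (\<Sum>a=i..num_links P. link_mass P a * gravity P * link_length P i)"

lemma inertia_const_commute: "inertia_const P i j = inertia_const P j i"
  by (auto simp: inertia_const_def max.commute)

lemma link_momentum_remove:
  assumes "i \<in> {1..num_links P}"
  shows "link_momentum P v w i = inertia_const P i i *\<^sub>R w i +
    (inertia_const P i 0 *\<^sub>R v + (\<Sum>j\<in>{1..num_links P} - {i}. inertia_const P i j *\<^sub>R w j))"
  using sum.remove [OF _ assms, of "\<lambda>j. inertia_const P i j *\<^sub>R w j"]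
  by (simp add: link_momentum_def)

lemma position_equation_iff:
  "position_equation P f R xdd qdd \<longleftrightarrow>
    (inertia_const P 0 0 * gravity P) *\<^sub>R e3 - f *\<^sub>R (R *v e3) - body_momentum P xdd qdd = 0"
  by (auto simp: position_equation_def body_momentum_def algebra_simps)

text \<open>The link equation is the residual crossed twice with \<open>q i\<close>. Expanding only
  the \<open>qdd i\<close> term, with its radial component given by \<open>acc\<close>, produces
  \<open>M\<^sub>i\<^sub>i qdd i\<close> and the centripetal term. Crossing twice gives 0 exactly
  when crossing once does.\<close>

lemma link_equation_iff:
  assumes i: "i \<in> {1..num_links P}" and unit: "norm (q i) = 1"
    and acc: "q i \<bullet> qdd i = - (norm (qd i))\<^sup>2"
  shows "link_equation P xdd q qd qdd i \<longleftrightarrow>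
    cross3 (q i) (link_weight P i *\<^sub>R e3 - link_momentum P xdd qdd i) = 0"
proof -
  let ?m = "inertia_const P i i"
  define F where "F = inertia_const P i 0 *\<^sub>R xdd
    + (\<Sum>j\<in>{1..num_links P} - {i}. inertia_const P i j *\<^sub>R qdd j)"
  have "cross3 (q i) (cross3 (q i) (link_weight P i *\<^sub>R e3 - link_momentum P xdd qdd i)) =
      link_weight P i *\<^sub>R cross3 (q i) (cross3 (q i) e3)
      - ?m *\<^sub>R cross3 (q i) (cross3 (q i) (qdd i)) - cross3 (q i) (cross3 (q i) F)"
    unfolding link_momentum_remove [OF i] F_def [symmetric]
    by (simp add: Cross3.right_diff_distrib cross_add_right cross_mult_right)
  also have "\<dots> = ?m *\<^sub>R qdd i - cross3 (q i) (cross3 (q i) F) -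
      (- (?m * (norm (qd i))\<^sup>2) *\<^sub>R q i - link_weight P i *\<^sub>R cross3 (q i) (cross3 (q i) e3))"
    unfolding cross_cross_unit [OF unit, of "qdd i"] acc by (simp add: algebra_simps)
  finally show ?thesis
    unfolding link_equation_def F_def [symmetric] link_weight_def [symmetric]
      matrix_vector_mul_assoc [symmetric] hat_mult_vec
    using cross_cross_unit_eq_0_iff [OF unit] by (metis eq_iff_diff_eq_0)
qed

lemma block_mult_vec_split:
  "block_mult_vec n A (block_vec v w) i = A i 0 *v v + (\<Sum>j=1..n. A i j *v w j)"
  unfolding block_mult_vec_def sum.atLeast_Suc_atMost [OF le0]
  by (simp add: block_vec_def)

lemma ball_0_to_n: "(\<forall>i\<in>{0..n}. Q i) \<longleftrightarrow> Q 0 \<and> (\<forall>i\<in>{1..n}. Q i)" for n :: nat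
proof -
  have "{0..n} = insert 0 {1..n}"
    by auto
  then show ?thesis
    by simp
qed

lemma scaleR_mat_1_mult_vec: "(c *\<^sub>R mat 1) *v v = c *\<^sub>R (v :: real^'n)"
  by (simp add: scaleR_matrix_vector_assoc [symmetric])

lemma uminus_matrix_vector_mult: "(- A) *v v = - (A *v (v :: real^'n))"
  by (simp add: vec_eq_iff matrix_vector_mult_def sum_negf)

lemma direction_matrix_equation_iff:
  "direction_matrix_equation P f R xdd q qd qdd \<longleftrightarrow>
    position_equation P f R xdd qdd \<and> (\<forall>i\<in>{1..num_links P}. link_equation P xdd q qd qdd i)"
proof -
  have "block_mult_vec (num_links P) (direction_matrix P q) (block_vec xdd qdd) i =
      inertia_const P i i *\<^sub>R qdd i - (hat (q i) ** hat (q i)) *v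
        (inertia_const P i 0 *\<^sub>R xdd + (\<Sum>j\<in>{1..num_links P} - {i}. inertia_const P i j *\<^sub>R qdd j))"
    if i: "i \<in> {1..num_links P}" for i
  proof -
    have "(\<Sum>j=1..num_links P. direction_matrix P q i j *v qdd j) = inertia_const P i i *\<^sub>R qdd i +
        (\<Sum>j\<in>{1..num_links P} - {i}. direction_matrix P q i j *v qdd j)"
      using i by (subst sum.remove [OF _ i]) (auto simp: direction_matrix_def scaleR_mat_1_mult_vec)
    \<comment> \<open>All off-diagonal blocks of row \<open>i\<close> share the factor
      \<open>hat (q i) ** hat (q i)\<close>, which moves out of the sum by linearity.\<close>
    also have "(\<Sum>j\<in>{1..num_links P} - {i}. direction_matrix P q i j *v qdd j) =
        - ((hat (q i) ** hat (q i)) *v (\<Sum>j\<in>{1..num_links P} - {i}. inertia_const P i j *\<^sub>R qdd j))"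
      unfolding linear_sum [OF matrix_vector_mul_linear] sum_negf [symmetric]
      using i by (intro sum.cong) (auto simp: direction_matrix_def matrix_vector_mult_scaleR
          uminus_matrix_vector_mult scaleR_matrix_vector_assoc [symmetric])
    finally show ?thesis
      using i by (simp add: block_mult_vec_split direction_matrix_def matrix_vector_right_distrib
          matrix_vector_mult_scaleR uminus_matrix_vector_mult scaleR_matrix_vector_assoc [symmetric])
  qed
  moreover have "block_mult_vec (num_links P) (direction_matrix P q) (block_vec xdd qdd) 0 =
      inertia_const P 0 0 *\<^sub>R xdd + (\<Sum>i=1..num_links P. inertia_const P 0 i *\<^sub>R qdd i)"
    by (simp add: block_mult_vec_split direction_matrix_def scaleR_mat_1_mult_vec)
  ultimately show ?thesis
    unfolding direction_matrix_equation_def ball_0_to_n position_equation_def link_equation_def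
    by (simp add: direction_rhs_def mult.commute)
qed

text \<open>After \<open>qdd\<close> is expressed by \<open>\<omega>\<close> and
  \<open>\<omega>d\<close>, link row \<open>i\<close> of the system, left side minus right side, is
  minus the residual crossed once with \<open>q i\<close>. Row 0 becomes the position
  equation.\<close>

lemma velocity_matrix_equation_iff:
  assumes unit: "\<And>i. i \<in> {1..num_links P} \<Longrightarrow> norm (q i) = 1"
    and orth: "\<And>i. i \<in> {1..num_links P} \<Longrightarrow> q i \<bullet> \<omega>d i = 0"
    and qdd: "\<And>i. i \<in> {1..num_links P} \<Longrightarrow>
      qdd i = cross3 (\<omega>d i) (q i) - (norm (\<omega> i))\<^sup>2 *\<^sub>R q i"
  shows "velocity_matrix_equation P f R xdd q \<omega> \<omega>d \<longleftrightarrow>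
    position_equation P f R xdd qdd \<and>
    (\<forall>i\<in>{1..num_links P}. cross3 (q i) (link_weight P i *\<^sub>R e3 - link_momentum P xdd qdd i) = 0)"
proof -
  let ?n = "num_links P"
  let ?L = "block_mult_vec ?n (velocity_matrix P q) (block_vec xdd \<omega>d)"
  have qdd': "qdd i = - cross3 (q i) (\<omega>d i) - (norm (\<omega> i))\<^sup>2 *\<^sub>R q i" if "i \<in> {1..?n}" for i
    using qdd [OF that] cross_skew [of "\<omega>d i" "q i"] by simp
  have "?L i - velocity_rhs P f R q \<omega> i =
      - cross3 (q i) (link_weight P i *\<^sub>R e3 - link_momentum P xdd qdd i)"
    if i: "i \<in> {1..?n}" for i
  proof -
    have lin: "linear (cross3 (q i))"
      using bilinear_cross by (simp add: bilinear_def)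
    let ?J = "{1..?n} - {i}"
    have "(\<Sum>j=1..?n. velocity_matrix P q i j *v \<omega>d j) = inertia_const P i i *\<^sub>R \<omega>d i +
        (\<Sum>j\<in>?J. velocity_matrix P q i j *v \<omega>d j)"
      using i by (subst sum.remove [OF _ i]) (auto simp: velocity_matrix_def scaleR_mat_1_mult_vec)
    also have "(\<Sum>j\<in>?J. velocity_matrix P q i j *v \<omega>d j) =
        (\<Sum>j\<in>?J. - inertia_const P i j *\<^sub>R cross3 (q i) (cross3 (q j) (\<omega>d j)))"
      using i by (intro sum.cong) (auto simp: velocity_matrix_def hat_mult_vec
          uminus_matrix_vector_mult scaleR_matrix_vector_assoc [symmetric] matrix_vector_mul_assoc [symmetric])
    finally have "?L i = inertia_const P i 0 *\<^sub>R cross3 (q i) xdd + (inertia_const P i i *\<^sub>R \<omega>d i +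
        (\<Sum>j\<in>?J. - inertia_const P i j *\<^sub>R cross3 (q i) (cross3 (q j) (\<omega>d j))))"
      using i by (simp add: block_mult_vec_split velocity_matrix_def hat_mult_vec
          scaleR_matrix_vector_assoc [symmetric])
    moreover have "velocity_rhs P f R q \<omega> i =
        (\<Sum>j\<in>?J. (inertia_const P i j * (norm (\<omega> j))\<^sup>2) *\<^sub>R cross3 (q i) (q j))
        + link_weight P i *\<^sub>R cross3 (q i) e3"
      using i by (simp add: velocity_rhs_def link_weight_def hat_mult_vec)
    \<comment> \<open>Crossing with \<open>q i\<close> kills the centripetal part of
      \<open>qdd i\<close>, and orthogonality of \<open>\<omega>d i\<close> to \<open>q i\<close>
      leaves just \<open>\<omega>d i\<close>. This yields the diagonal block.\<close>
    moreover have "cross3 (q i) (qdd i) = \<omega>d i"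
      using cross_cross_unit [OF unit [OF i], of "\<omega>d i"] orth [OF i]
      by (simp add: qdd' [OF i] Cross3.right_diff_distrib cross_mult_right)
    moreover have "cross3 (q i) (\<Sum>j\<in>?J. inertia_const P i j *\<^sub>R qdd j) =
        (\<Sum>j\<in>?J. - inertia_const P i j *\<^sub>R cross3 (q i) (cross3 (q j) (\<omega>d j)))
        - (\<Sum>j\<in>?J. (inertia_const P i j * (norm (\<omega> j))\<^sup>2) *\<^sub>R cross3 (q i) (q j))"
      unfolding linear_sum [OF lin] sum_subtractf [symmetric]
      by (intro sum.cong) (auto simp: qdd' Cross3.right_diff_distrib cross_mult_right algebra_simps)
    ultimately show ?thesis
      unfolding link_momentum_remove [OF i]
      by (simp add: Cross3.right_diff_distrib cross_add_right cross_mult_right)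
  qed
  then have "(?L i = velocity_rhs P f R q \<omega> i) \<longleftrightarrow>
      cross3 (q i) (link_weight P i *\<^sub>R e3 - link_momentum P xdd qdd i) = 0" if "i \<in> {1..?n}" for i
    using that by (metis eq_iff_diff_eq_0 neg_equal_0_iff_equal)
  moreover have "?L 0 = velocity_rhs P f R q \<omega> 0 \<longleftrightarrow> position_equation P f R xdd qdd"
  proof -
    have L: "?L 0 = inertia_const P 0 0 *\<^sub>R xdd +
        (\<Sum>j=1..?n. - inertia_const P 0 j *\<^sub>R cross3 (q j) (\<omega>d j))"
      unfolding block_mult_vec_split
      by (intro arg_cong2 [where f = "(+)"] sum.cong)
        (auto simp: velocity_matrix_def hat_mult_vec scaleR_mat_1_mult_vec
          uminus_matrix_vector_mult scaleR_matrix_vector_assoc [symmetric])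
    have S: "(\<Sum>i=1..?n. inertia_const P 0 i *\<^sub>R qdd i) =
        (\<Sum>j=1..?n. - inertia_const P 0 j *\<^sub>R cross3 (q j) (\<omega>d j)) -
        (\<Sum>j=1..?n. (inertia_const P 0 j * (norm (\<omega> j))\<^sup>2) *\<^sub>R q j)"
      unfolding sum_subtractf [symmetric]
      by (intro sum.cong) (auto simp: qdd' algebra_simps)
    show ?thesis
      unfolding position_equation_def velocity_rhs_def L S if_P [OF refl] by (auto simp: algebra_simps)
  qed
  ultimately show ?thesis
    by (simp add: velocity_matrix_equation_def ball_0_to_n)
qed

section \<open>The derivative of the Lagrangian along a family of states\<close>

lemma lagrangian_eq:
  "lagrangian P y p v u w =
    1/2 * (inertia_const P 0 0 * (v \<bullet> v))
    + v \<bullet> (\<Sum>i=1..num_links P. inertia_const P 0 i *\<^sub>R w i)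
    + 1/2 * (\<Sum>i=1..num_links P. \<Sum>j=1..num_links P. inertia_const P i j * (w i \<bullet> w j))
    + 1/2 * (u \<bullet> (body_inertia P *v u))
    + (\<Sum>i=1..num_links P. link_weight P i * (e3 \<bullet> p i))
    + inertia_const P 0 0 * gravity P * (e3 \<bullet> y)"
  by (simp add: lagrangian_def kinetic_energy_def potential_energy_def link_weight_def
      power2_norm_eq_inner sum_distrib_right)

text \<open>The product rule yields two halves for each quadratic form. Symmetry of the inertia
  constants and of \<open>body_inertia P\<close> merges them and cancels the factor 1/2, so that the
  coefficients become momenta.\<close>

lemma lagrangian_has_vector_derivative:
  assumes sym: "transpose (body_inertia P) = body_inertia P"
    and y: "(y has_vector_derivative y') F"
    and p: "\<And>i. i \<in> {1..num_links P} \<Longrightarrow> ((\<lambda>s. p s i) has_vector_derivative p' i) F"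
    and v: "(v has_vector_derivative v') F"
    and u: "(u has_vector_derivative u') F"
    and w: "\<And>i. i \<in> {1..num_links P} \<Longrightarrow> ((\<lambda>s. w s i) has_vector_derivative w' i) F"
    and F: "F = at s within S"
  shows "((\<lambda>s. lagrangian P (y s) (p s) (v s) (u s) (w s)) has_vector_derivative
      body_momentum P (v s) (w s) \<bullet> v'
      + (\<Sum>i=1..num_links P. link_momentum P (v s) (w s) i \<bullet> w' i)
      + (body_inertia P *v u s) \<bullet> u'
      + (\<Sum>i=1..num_links P. link_weight P i * (e3 \<bullet> p' i))
      + inertia_const P 0 0 * gravity P * (e3 \<bullet> y')) F"
proof -
  let ?n = "num_links P" and ?m = "inertia_const P" and ?J = "body_inertia P"
  have "((\<lambda>s. lagrangian P (y s) (p s) (v s) (u s) (w s)) has_vector_derivative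
      1/2 * (?m 0 0 * (v s \<bullet> v' + v' \<bullet> v s))
      + (v s \<bullet> (\<Sum>i=1..?n. ?m 0 i *\<^sub>R w' i) + v' \<bullet> (\<Sum>i=1..?n. ?m 0 i *\<^sub>R w s i))
      + 1/2 * (\<Sum>i=1..?n. \<Sum>j=1..?n. ?m i j * (w s i \<bullet> w' j + w' i \<bullet> w s j))
      + 1/2 * (u s \<bullet> (?J *v u') + u' \<bullet> (?J *v u s))
      + (\<Sum>i=1..?n. link_weight P i * (e3 \<bullet> p' i))
      + ?m 0 0 * gravity P * (e3 \<bullet> y')) F"
    unfolding lagrangian_eq F
    by (intro has_vector_derivative_add has_vector_derivative_mult_right has_vector_derivative_sum
        has_vector_derivative_inner [where f = v and g = v]
        has_vector_derivative_inner [where f = v] has_vector_derivative_inner [where f = u]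
        has_vector_derivative_inner [where f = "\<lambda>s. w s i" for i]
        has_vector_derivative_matrix_vector_mult
        bounded_linear.has_vector_derivative [OF bounded_linear_inner_right]
        bounded_linear.has_vector_derivative [OF bounded_linear_scaleR_right]
        y [unfolded F] v [unfolded F] u [unfolded F] p [unfolded F] w [unfolded F])
  moreover have "(\<Sum>i=1..?n. \<Sum>j=1..?n. ?m i j * (w s i \<bullet> w' j + w' i \<bullet> w s j)) =
      2 * (\<Sum>i=1..?n. \<Sum>j=1..?n. ?m i j * (w s j \<bullet> w' i))"
  proof -
    \<comment> \<open>Exchanging the two summation indices turns one half of the quadratic form into
      the other.\<close>
    have "(\<Sum>i=1..?n. \<Sum>j=1..?n. ?m i j * (w s i \<bullet> w' j)) =
        (\<Sum>i=1..?n. \<Sum>j=1..?n. ?m i j * (w s j \<bullet> w' i))"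
      by (subst sum.swap) (simp add: inertia_const_commute [of P])
    then show ?thesis
      by (simp add: distrib_left sum.distrib inner_commute)
  qed
  moreover have "u s \<bullet> (?J *v u') = (?J *v u s) \<bullet> u'"
    using sym by (metis dot_lmul_matrix inner_commute transpose_matrix_vector)
  moreover have "body_momentum P (v s) (w s) \<bullet> v' =
      ?m 0 0 * (v s \<bullet> v') + v' \<bullet> (\<Sum>i=1..?n. ?m 0 i *\<^sub>R w s i)"
    by (simp add: body_momentum_def inner_add_right inner_add_left inner_commute)
  moreover have "(\<Sum>i=1..?n. link_momentum P (v s) (w s) i \<bullet> w' i) =
      v s \<bullet> (\<Sum>i=1..?n. ?m 0 i *\<^sub>R w' i) + (\<Sum>i=1..?n. \<Sum>j=1..?n. ?m i j * (w s j \<bullet> w' i))"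
    by (simp add: link_momentum_def inner_add_left inner_sum_left inner_sum_right sum.distrib
        inertia_const_commute [of P _ 0])
  ultimately show ?thesis
    by (simp add: inner_commute add_ac)
qed

text \<open>Link velocities are identified only for indices in \<open>{1..num_links P}\<close>; this
  permits replacing them under the Lagrangian.\<close>

lemma lagrangian_cong:
  assumes "\<And>i. i \<in> {1..num_links P} \<Longrightarrow> p i = p' i" "\<And>i. i \<in> {1..num_links P} \<Longrightarrow> w i = w' i"
  shows "lagrangian P y p v u w = lagrangian P y p' v u w'"
  unfolding lagrangian_eq using assms by (intro arg_cong2 [where f = "(+)"] arg_cong2 [where f = "(*)"]
      arg_cong2 [where f = "(\<bullet>)"] sum.cong refl; simp)

section \<open>Motions and their variations\<close>

locale quadrotor_motion =
  fixes P :: quadrotor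
    and t0 tf :: real
    and f :: "real \<Rightarrow> real"
    and M :: "real \<Rightarrow> real^3"
    and x xd xdd :: "real \<Rightarrow> real^3"
    and R :: "real \<Rightarrow> real^3^3"
    and \<Omega> \<Omega>d :: "real \<Rightarrow> real^3"
    and q qd qdd :: "nat \<Rightarrow> real \<Rightarrow> real^3"
  assumes inertia_sym: "transpose (body_inertia P) = body_inertia P"
    and time: "t0 < tf"
    and f: "continuous_on {t0..tf} f"
    and M: "continuous_on {t0..tf} M"
    and x: "\<And>t. t \<in> {t0..tf} \<Longrightarrow> (x has_vector_derivative xd t) (at t within {t0..tf})"
    and xd: "\<And>t. t \<in> {t0..tf} \<Longrightarrow> (xd has_vector_derivative xdd t) (at t within {t0..tf})"
    and xdd: "continuous_on {t0..tf} xdd"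
    and R_SO3: "\<And>t. t \<in> {t0..tf} \<Longrightarrow> rotation_matrix (R t)"
    and R: "\<And>t. t \<in> {t0..tf} \<Longrightarrow> (R has_vector_derivative R t ** hat (\<Omega> t)) (at t within {t0..tf})"
    and \<Omega>: "\<And>t. t \<in> {t0..tf} \<Longrightarrow> (\<Omega> has_vector_derivative \<Omega>d t) (at t within {t0..tf})"
    and \<Omega>d: "continuous_on {t0..tf} \<Omega>d"
    and q_S2: "\<And>i t. i \<in> {1..num_links P} \<Longrightarrow> t \<in> {t0..tf} \<Longrightarrow> norm (q i t) = 1"
    and q: "\<And>i t. i \<in> {1..num_links P} \<Longrightarrow> t \<in> {t0..tf} \<Longrightarrow>
              (q i has_vector_derivative qd i t) (at t within {t0..tf})"
    and qd: "\<And>i t. i \<in> {1..num_links P} \<Longrightarrow> t \<in> {t0..tf} \<Longrightarrow>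
              (qd i has_vector_derivative qdd i t) (at t within {t0..tf})"
    and qdd: "\<And>i. i \<in> {1..num_links P} \<Longrightarrow> continuous_on {t0..tf} (qdd i)"
begin

section \<open>Kinematic consequences of the constraints\<close>

lemma derivative_unique:
  assumes "t \<in> {t0..tf}" "(c has_vector_derivative c') (at t within {t0..tf})"
    and "(d has_vector_derivative d') (at t within {t0..tf})" "\<And>t. t \<in> {t0..tf} \<Longrightarrow> c t = d t"
  shows "c' = d'"
proof -
  have "(d has_vector_derivative c') (at t within {t0..tf})"
    using assms(4) by (intro has_vector_derivative_transform [OF assms(1) _ assms(2)]) simp
  from vector_derivative_unique_within_closed_interval [OF time, unfolded box_real, OF assms(1) this assms(3)]
  show ?thesis .
qed

lemma time_deriv_eq:
  assumes "t \<in> {t0..tf}" "(c has_vector_derivative c') (at t within {t0..tf})"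
  shows "time_deriv t0 tf c t = c'"
  using vector_derivative_within_cbox [OF time, unfolded box_real, OF assms] by (simp add: time_deriv_def)

text \<open>Differentiate the constraint q \<bullet> q = 1 in time; \<open>q_qdd\<close>
  differentiates the result once more.\<close>

lemma q_qd_orthogonal:
  assumes "i \<in> {1..num_links P}" "t \<in> {t0..tf}"
  shows "q i t \<bullet> qd i t = 0"
proof -
  have "q i t \<bullet> qd i t + qd i t \<bullet> q i t = 0"
    by (rule derivative_unique [OF assms(2), of "\<lambda>t. q i t \<bullet> q i t" _ "\<lambda>t. 1"])
      (use assms q_S2 in \<open>auto simp: norm_eq_1 intro!: has_vector_derivative_inner q\<close>)
  then show ?thesis
    by (simp add: inner_commute)
qed

lemma q_qdd:
  assumes "i \<in> {1..num_links P}" "t \<in> {t0..tf}"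
  shows "q i t \<bullet> qdd i t = - (norm (qd i t))\<^sup>2"
proof -
  have "q i t \<bullet> qdd i t + qd i t \<bullet> qd i t = 0"
    by (rule derivative_unique [OF assms(2), of "\<lambda>t. q i t \<bullet> qd i t" _ "\<lambda>t. 0"])
      (use assms q_qd_orthogonal in \<open>auto intro!: has_vector_derivative_inner q qd\<close>)
  then show ?thesis
    by (simp add: power2_norm_eq_inner)
qed

lemma link_angular_velocities_exist:
  "\<exists>\<omega> \<omega>d. link_angular_velocities (num_links P) t0 tf q \<omega> \<omega>d"
proof (intro exI)
  \<comment> \<open>The witness is \<open>q \<times> qd\<close>, which is orthogonal to
    \<open>q\<close> and reproduces \<open>qd\<close> because \<open>qd\<close> is orthogonal to the
    unit vector \<open>q\<close>. Its derivative is \<open>q \<times> qdd\<close>, since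
    \<open>qd \<times> qd\<close> vanishes.\<close>
  have vel: "cross3 (cross3 (q i t) (qd i t)) (q i t) = qd i t"
    if "i \<in> {1..num_links P}" "t \<in> {t0..tf}" for i t
    using cross_cross_unit [OF q_S2 [OF that], of "qd i t"] q_qd_orthogonal [OF that]
      cross_skew [of "cross3 (q i t) (qd i t)" "q i t"] by simp
  have "((\<lambda>t. cross3 (q i t) (qd i t)) has_vector_derivative cross3 (q i t) (qdd i t))
      (at t within {t0..tf})" if "i \<in> {1..num_links P}" "t \<in> {t0..tf}" for i t
    using has_vector_derivative_cross3 [OF q [OF that] qd [OF that]] by simp
  then show "link_angular_velocities (num_links P) t0 tf q
      (\<lambda>i t. cross3 (q i t) (qd i t)) (\<lambda>i t. cross3 (q i t) (qdd i t))"
    unfolding link_angular_velocities_def by (simp add: dot_cross_self vel q)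
qed

text \<open>Differentiate q \<bullet> \<omega> = 0, and differentiate qd = \<omega> \<times> q;
  orthogonality reduces \<omega> \<times> (\<omega> \<times> q) to
  \<open>- (norm \<omega>)\<^sup>2 *\<^sub>R q\<close>.\<close>

lemma link_angular_velocitiesD:
  assumes \<omega>: "link_angular_velocities (num_links P) t0 tf q \<omega> \<omega>d"
    and i: "i \<in> {1..num_links P}" and t: "t \<in> {t0..tf}"
  shows "q i t \<bullet> \<omega>d i t = 0"
    and "qdd i t = cross3 (\<omega>d i t) (q i t) - (norm (\<omega> i t))\<^sup>2 *\<^sub>R q i t"
proof -
  have orth: "q i t \<bullet> \<omega> i t = 0"
    and dq: "(q i has_vector_derivative cross3 (\<omega> i t) (q i t)) (at t within {t0..tf})"
    and d\<omega>: "(\<omega> i has_vector_derivative \<omega>d i t) (at t within {t0..tf})" if "t \<in> {t0..tf}" for t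
    using \<omega> i that unfolding link_angular_velocities_def by blast+
  have "q i t \<bullet> \<omega>d i t + cross3 (\<omega> i t) (q i t) \<bullet> \<omega> i t = 0"
    by (rule derivative_unique [OF t, of "\<lambda>t. q i t \<bullet> \<omega> i t" _ "\<lambda>t. 0"])
      (use t orth dq d\<omega> in \<open>auto intro!: has_vector_derivative_inner\<close>)
  then show "q i t \<bullet> \<omega>d i t = 0"
    by (simp add: dot_cross_self)
  have "qd i t = cross3 (\<omega> i t) (q i t)" if "t \<in> {t0..tf}" for t
    using derivative_unique [OF that q [OF i that] dq [OF that]] by simp
  then have "qdd i t = cross3 (\<omega> i t) (cross3 (\<omega> i t) (q i t)) + cross3 (\<omega>d i t) (q i t)"
    by (intro derivative_unique [OF t qd [OF i t]
          has_vector_derivative_cross3 [OF d\<omega> [OF t] dq [OF t]]])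
  then show "qdd i t = cross3 (\<omega>d i t) (q i t) - (norm (\<omega> i t))\<^sup>2 *\<^sub>R q i t"
    using orth [OF t] by (simp add: Lagrange power2_norm_eq_inner inner_commute)
qed

section \<open>Residuals of the equations of motion and the first variation of the action\<close>

definition position_residual :: "real \<Rightarrow> real^3"
  where "position_residual t = (inertia_const P 0 0 * gravity P) *\<^sub>R e3 - f t *\<^sub>R (R t *v e3)
    - body_momentum P (xdd t) (\<lambda>i. qdd i t)"

text \<open>A full vector in space. Link variations are tangent to the sphere, so the equation of
  motion concerns only its part orthogonal to \<open>q i\<close>; hence the cross products with
  \<open>q i\<close> below.\<close>

definition link_residual :: "nat \<Rightarrow> real \<Rightarrow> real^3"
  where "link_residual i t = link_weight P i *\<^sub>R e3 - link_momentum P (xdd t) (\<lambda>i. qdd i t) i"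

definition attitude_residual :: "real \<Rightarrow> real^3"
  where "attitude_residual t =
    M t - (body_inertia P *v \<Omega>d t + hat (\<Omega> t) *v (body_inertia P *v \<Omega> t))"

lemma equations_iff_residuals:
  assumes "t \<in> {t0..tf}"
  shows "position_equation P (f t) (R t) (xdd t) (\<lambda>i. qdd i t) \<longleftrightarrow> position_residual t = 0"
    and "i \<in> {1..num_links P} \<Longrightarrow>
      link_equation P (xdd t) (\<lambda>i. q i t) (\<lambda>i. qd i t) (\<lambda>i. qdd i t) i \<longleftrightarrow>
      cross3 (q i t) (link_residual i t) = 0"
    and "attitude_equation P (M t) (\<Omega> t) (\<Omega>d t) \<longleftrightarrow> attitude_residual t = 0"
  using assms
  by (auto simp: position_equation_iff position_residual_def link_residual_def
      link_equation_iff q_S2 q_qdd attitude_equation_def attitude_residual_def)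

lemma continuous_on_curves:
  "continuous_on {t0..tf} R" "continuous_on {t0..tf} \<Omega>"
  "i \<in> {1..num_links P} \<Longrightarrow> continuous_on {t0..tf} (q i)"
  by (rule continuous_on_vector_derivative, erule R \<Omega> q; assumption?)+

lemma continuous_on_residuals:
  "continuous_on {t0..tf} position_residual"
  "continuous_on {t0..tf} (link_residual i)"
  "continuous_on {t0..tf} attitude_residual"
  unfolding position_residual_def link_residual_def attitude_residual_def body_momentum_def
    link_momentum_def hat_mult_vec
  by (intro continuous_intros continuous_on_cross f M xdd qdd \<Omega>d continuous_on_curves; assumption)+

text \<open>From the \<open>s\<close>-derivative of the Lagrangian plus the virtual work, subtract
  the time derivative of the momenta paired with the variation. That derivative integrates to 0, and
  the remainder no longer contains time derivatives of the variation.\<close>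

lemma first_variation:
  assumes var: "variation (num_links P) t0 tf x R q e X A Q \<delta>x \<eta> \<xi>"
  shows "\<exists>D. ((\<lambda>s. action P t0 tf (X s) (A s) (Q s)) has_real_derivative D) (at 0) \<and>
    D + integral {t0..tf} (\<lambda>t. (- f t *\<^sub>R (R t *v e3)) \<bullet> \<delta>x t + M t \<bullet> \<eta> t) =
    integral {t0..tf} (\<lambda>t. position_residual t \<bullet> \<delta>x t +
      (\<Sum>i=1..num_links P. link_residual i t \<bullet> cross3 (\<xi> i t) (q i t)) + attitude_residual t \<bullet> \<eta> t)"
proof -
  let ?n = "num_links P" and ?J = "body_inertia P" and ?I = "{1..num_links P}"
  let ?T = "{t0..tf}" and ?S = "{-e<..<e}"
  let ?vee = "\<lambda>A B :: real^3^3. vee (transpose A ** B)"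
  interpret vee: bounded_bilinear ?vee
    by (rule bounded_bilinear_vee)

  have e: "0 < e"
    and C2: "C2_family e t0 tf X" "C2_family e t0 tf A"
      "\<forall>i\<in>?I. C2_family e t0 tf (\<lambda>s. Q s i)"
    and rot: "\<And>s t. s \<in> ?S \<Longrightarrow> t \<in> ?T \<Longrightarrow> rotation_matrix (A s t)"
    and X0: "\<And>t. t \<in> ?T \<Longrightarrow> X 0 t = x t"
    and A0: "\<And>t. t \<in> ?T \<Longrightarrow> A 0 t = R t"
    and Q0: "\<And>i t. i \<in> ?I \<Longrightarrow> t \<in> ?T \<Longrightarrow> Q 0 i t = q i t"
    and dX: "\<And>t. t \<in> ?T \<Longrightarrow> ((\<lambda>s. X s t) has_vector_derivative \<delta>x t) (at 0)"
    and dA: "\<And>t. t \<in> ?T \<Longrightarrow> ((\<lambda>s. A s t) has_vector_derivative R t ** hat (\<eta> t)) (at 0)"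
    and dQ: "\<And>i t. i \<in> ?I \<Longrightarrow> t \<in> ?T \<Longrightarrow>
      ((\<lambda>s. Q s i t) has_vector_derivative cross3 (\<xi> i t) (q i t)) (at 0)"
    and ends: "\<And>t. t \<in> {t0, tf} \<Longrightarrow> \<delta>x t = 0" "\<And>t. t \<in> {t0, tf} \<Longrightarrow> \<eta> t = 0"
      "\<And>i t. i \<in> ?I \<Longrightarrow> t \<in> {t0, tf} \<Longrightarrow> \<xi> i t = 0"
    using var unfolding variation_def by blast+
  have 0: "0 \<in> ?S"
    using e by simp
  have t0tf: "t0 \<in> ?T" "tf \<in> ?T"
    using time by auto
  \<comment> \<open>\<open>Xts\<close> is the variation of the velocity, the
    \<open>s\<close>-derivative of \<open>Xt\<close>. By \<open>C1_family_mixed_partial\<close> it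
    is also the time derivative of the variation \<open>Xs\<close>; likewise for \<open>A\<close>
    and \<open>Q\<close>.\<close>
  obtain Xs Xt Xts Xtt where X: "C1_family e t0 tf X Xs Xt" and Xt: "C1_family e t0 tf Xt Xts Xtt"
    using C2(1) unfolding C2_family_def by blast
  obtain As At Ats Att where A: "C1_family e t0 tf A As At" and At: "C1_family e t0 tf At Ats Att"
    using C2(2) unfolding C2_family_def by blast
  have "\<forall>i\<in>?I. \<exists>Qs Qt Qts Qtt. C1_family e t0 tf (\<lambda>s. Q s i) Qs Qt \<and> C1_family e t0 tf Qt Qts Qtt"
    using C2(3) unfolding C2_family_def by blast
  then obtain Qs Qt Qts Qtt where
    Q: "\<And>i. i \<in> ?I \<Longrightarrow> C1_family e t0 tf (\<lambda>s. Q s i) (Qs i) (Qt i)" and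
    Qt: "\<And>i. i \<in> ?I \<Longrightarrow> C1_family e t0 tf (Qt i) (Qts i) (Qtt i)"
    by metis

  \<comment> \<open>An explicit formula for the angular velocity of the varied attitude, replacing
    the definite description in \<open>body_angular_velocity\<close>; \<open>Ws\<close> is its
    \<open>s\<close>-derivative by the product rule.\<close>
  define W where "W s t = ?vee (A s t) (At s t)" for s t
  define Ws where "Ws s t = ?vee (A s t) (Ats s t) + ?vee (As s t) (At s t)" for s t
  have W: "body_angular_velocity t0 tf (A s) t = W s t" if "s \<in> ?S" "t \<in> ?T" for s t
  proof (rule body_angular_velocity_eq [where R = "A s", OF time that(2) rot [OF that]])
    have "At s t = A s t ** hat (W s t)"
      unfolding W_def
      by (rule rotation_derivative [OF time that(2) rot [OF that(1)] C1_familyD(2) [OF A that]])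
    then show "(A s has_vector_derivative A s t ** hat (W s t)) (at t within {t0..tf})"
      using C1_familyD(2) [OF A that] by simp
  qed
  have dW: "((\<lambda>s. W s t) has_vector_derivative Ws s t) (at s)" if "s \<in> ?S" "t \<in> ?T" for s t
    unfolding W_def Ws_def
    by (rule vee.has_vector_derivative [OF C1_familyD(1) [OF A that] C1_familyD(1) [OF At that]])

  define L where "L s t = lagrangian P (X s t) (\<lambda>i. Q s i t) (Xt s t) (W s t) (\<lambda>i. Qt i s t)" for s t
  define L' where "L' s t = body_momentum P (Xt s t) (\<lambda>i. Qt i s t) \<bullet> Xts s t
      + (\<Sum>i=1..?n. link_momentum P (Xt s t) (\<lambda>i. Qt i s t) i \<bullet> Qts i s t)
      + (?J *v W s t) \<bullet> Ws s t
      + (\<Sum>i=1..?n. link_weight P i * (e3 \<bullet> Qs i s t))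
      + inertia_const P 0 0 * gravity P * (e3 \<bullet> Xs s t)" for s t
  have action: "action P t0 tf (X s) (A s) (Q s) = integral (cbox t0 tf) (L s)" if s: "s \<in> ?S" for s
    unfolding action_def L_def box_real
  proof (rule integral_cong)
    fix t assume t: "t \<in> ?T"
    have "time_deriv t0 tf (X s) t = Xt s t"
      by (rule time_deriv_eq [OF t C1_familyD(2) [OF X s t]])
    moreover have "time_deriv t0 tf (Q s i) t = Qt i s t" if "i \<in> ?I" for i
      by (rule time_deriv_eq [OF t C1_familyD(2) [OF Q [OF that] s t]])
    ultimately show "lagrangian P (X s t) (\<lambda>i. Q s i t) (time_deriv t0 tf (X s) t)
        (body_angular_velocity t0 tf (A s) t) (\<lambda>i. time_deriv t0 tf (Q s i) t) =
      lagrangian P (X s t) (\<lambda>i. Q s i t) (Xt s t) (W s t) (\<lambda>i. Qt i s t)"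
      unfolding W [OF s t] by (simp only:) (rule lagrangian_cong; simp)
  qed
  note cont =
    C1_family_continuous [OF X, unfolded split_beta] C1_familyD(3,4) [OF X, unfolded split_beta]
    C1_familyD(3) [OF Xt, unfolded split_beta]
    C1_family_continuous [OF A, unfolded split_beta] C1_familyD(3,4) [OF A, unfolded split_beta]
    C1_familyD(3) [OF At, unfolded split_beta]
    C1_family_continuous [OF Q, unfolded split_beta] C1_familyD(3,4) [OF Q, unfolded split_beta]
    C1_familyD(3) [OF Qt, unfolded split_beta]
  have contW: "continuous_on (?S \<times> ?T) (\<lambda>z. W (fst z) (snd z))"
    "continuous_on (?S \<times> ?T) (\<lambda>z. Ws (fst z) (snd z))"
    unfolding W_def Ws_def by (intro continuous_on_add vee.continuous_on cont)+
  have contL: "continuous_on (?S \<times> ?T) (\<lambda>(s, t). L s t)"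
    unfolding L_def lagrangian_eq split_beta by (intro continuous_intros cont contW; assumption)
  have contL': "continuous_on (?S \<times> ?T) (\<lambda>(s, t). L' s t)"
    unfolding L'_def body_momentum_def link_momentum_def split_beta
    by (intro continuous_intros cont contW; assumption)
  have "((\<lambda>s. integral (cbox t0 tf) (L s)) has_vector_derivative integral (cbox t0 tf) (L' 0))
      (at 0 within ?S)"
  proof (rule leibniz_rule_vector_derivative)
    show "((\<lambda>s. L s t) has_vector_derivative L' s t) (at s within ?S)"
      if "s \<in> ?S" "t \<in> cbox t0 tf" for s t
    proof -
      have t: "t \<in> ?T"
        using that by simp
      show ?thesis
        unfolding L_def L'_def
        by (rule has_vector_derivative_at_within, rule lagrangian_has_vector_derivative
            [OF inertia_sym C1_familyD(1) [OF X that(1) t] C1_familyD(1) [OF Q that(1) t]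
              C1_familyD(1) [OF Xt that(1) t] dW [OF that(1) t] C1_familyD(1) [OF Qt that(1) t] refl])
    qed
    show "L s integrable_on cbox t0 tf" if "s \<in> ?S" for s
      unfolding box_real by (rule integrable_continuous_real [OF continuous_on_slice [OF contL that]])
  qed (use 0 contL' in auto)
  then have "((\<lambda>s. integral (cbox t0 tf) (L s)) has_vector_derivative integral ?T (L' 0)) (at 0)"
    by (simp only: box_real has_vector_derivative_within_open [OF 0 open_greaterThanLessThan])
  then have deriv: "((\<lambda>s. action P t0 tf (X s) (A s) (Q s)) has_real_derivative integral ?T (L' 0)) (at 0)"
    unfolding has_real_derivative_iff_has_vector_derivative
    by (rule has_vector_derivative_transform_within_open [OF _ open_greaterThanLessThan 0])
      (simp add: action)

  \<comment> \<open>At \<open>s = 0\<close> the partial derivatives of the family are identified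
    with the velocities of the motion and with the prescribed variation.\<close>
  have Xt0: "Xt 0 t = xd t" if "t \<in> ?T" for t
    by (rule derivative_unique [OF that C1_familyD(2) [OF X 0 that] x [OF that] X0])
  have Qt0: "Qt i 0 t = qd i t" if "i \<in> ?I" "t \<in> ?T" for i t
    by (rule derivative_unique [OF that(2) C1_familyD(2) [OF Q [OF that(1)] 0 that(2)] q [OF that]
          Q0 [OF that(1)]])
  have At0: "At 0 t = R t ** hat (\<Omega> t)" if "t \<in> ?T" for t
    by (rule derivative_unique [OF that C1_familyD(2) [OF A 0 that] R [OF that] A0])
  have Xs0: "Xs 0 t = \<delta>x t" if "t \<in> ?T" for t
    by (rule vector_derivative_unique_at [OF C1_familyD(1) [OF X 0 that] dX [OF that]])
  have Qs0: "Qs i 0 t = cross3 (\<xi> i t) (q i t)" if "i \<in> ?I" "t \<in> ?T" for i t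
    by (rule vector_derivative_unique_at [OF C1_familyD(1) [OF Q [OF that(1)] 0 that(2)] dQ [OF that]])
  have As0: "As 0 t = R t ** hat (\<eta> t)" if "t \<in> ?T" for t
    by (rule vector_derivative_unique_at [OF C1_familyD(1) [OF A 0 that] dA [OF that]])
  have vee_rotated: "?vee (R t ** B) (R t ** C) = vee (transpose B ** C)" if "t \<in> ?T" for t B C
  proof -
    have "transpose (R t) ** R t = mat 1"
      using R_SO3 [OF that] by (simp add: rotation_matrix_def orthogonal_matrix)
    moreover have "transpose (R t ** B) ** (R t ** C) = transpose B ** (transpose (R t) ** R t) ** C"
      by (simp only: matrix_transpose_mul matrix_mul_assoc)
    ultimately show ?thesis
      by (simp only: matrix_mul_rid)
  qed
  have W0: "W 0 t = \<Omega> t" if "t \<in> ?T" for t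
    using vee_rotated [OF that, of "mat 1" "hat (\<Omega> t)"] by (simp add: W_def A0 [OF that] At0 [OF that])
  \<comment> \<open>The variation \<open>\<eta>\<close> is given only pointwise. This formula makes
    it differentiable in time, because \<open>As 0\<close> has the time derivative
    \<open>Ats 0\<close>.\<close>
  have \<eta>: "\<eta> t = ?vee (R t) (As 0 t)" if "t \<in> ?T" for t
    using vee_rotated [OF that, of "mat 1" "hat (\<eta> t)"] by (simp add: As0 [OF that])

  define \<eta>d where "\<eta>d t = ?vee (R t) (Ats 0 t) + ?vee (R t ** hat (\<Omega> t)) (As 0 t)" for t
  have d\<eta>: "(\<eta> has_vector_derivative \<eta>d t) (at t within ?T)" if "t \<in> ?T" for t
    unfolding \<eta>d_def
    by (rule has_vector_derivative_transform [OF that \<eta>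
          vee.has_vector_derivative [OF R [OF that] C1_family_mixed_partial [OF A At 0 that]]])
  \<comment> \<open>The identity \<delta>\<Omega> = \<eta>' + \<Omega> \<times> \<eta>: the
    product-rule formulas for \<open>Ws 0\<close> and \<open>\<eta>d\<close> share the term with
    \<open>Ats\<close>, and what remains differs by the commutator of \<open>hat \<Omega>\<close>
    and \<open>hat \<eta>\<close>.\<close>
  have Ws0: "Ws 0 t = \<eta>d t + cross3 (\<Omega> t) (\<eta> t)" if "t \<in> ?T" for t
  proof -
    have "cross3 (\<Omega> t) (\<eta> t) = vee (hat (\<Omega> t) ** hat (\<eta> t)) - vee (hat (\<eta> t) ** hat (\<Omega> t))"
      using vee_hat [of "cross3 (\<Omega> t) (\<eta> t)"] by (simp add: hat_cross linear_diff [OF linear_vee])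
    moreover have "transpose (hat v) ** B = - (hat v ** B)" for v and B :: "real^3^3"
      by (simp add: vec_eq_iff forall_3 transpose_def hat_components matrix_matrix_mult_def sum_3)
    ultimately show ?thesis
      by (simp add: Ws_def \<eta>d_def A0 [OF that] At0 [OF that] As0 [OF that] vee_rotated [OF that]
          linear_neg [OF linear_vee])
  qed

  \<comment> \<open>The momenta paired with the variation. Integration by parts is carried out by
    integrating \<open>K'\<close> and using that the variation vanishes at both ends.\<close>
  define K where "K t = body_momentum P (xd t) (\<lambda>i. qd i t) \<bullet> Xs 0 t
    + (\<Sum>i=1..?n. link_momentum P (xd t) (\<lambda>i. qd i t) i \<bullet> Qs i 0 t) + (?J *v \<Omega> t) \<bullet> \<eta> t" for t
  define K' where "K' t = (body_momentum P (xd t) (\<lambda>i. qd i t) \<bullet> Xts 0 t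
      + body_momentum P (xdd t) (\<lambda>i. qdd i t) \<bullet> Xs 0 t)
    + (\<Sum>i=1..?n. link_momentum P (xd t) (\<lambda>i. qd i t) i \<bullet> Qts i 0 t
      + link_momentum P (xdd t) (\<lambda>i. qdd i t) i \<bullet> Qs i 0 t)
    + ((?J *v \<Omega> t) \<bullet> \<eta>d t + (?J *v \<Omega>d t) \<bullet> \<eta> t)" for t
  have K: "(K has_vector_derivative K' t) (at t within ?T)" if t: "t \<in> ?T" for t
  proof -
    have mom: "((\<lambda>t. body_momentum P (xd t) (\<lambda>i. qd i t)) has_vector_derivative
        body_momentum P (xdd t) (\<lambda>i. qdd i t)) (at t within ?T)"
      "((\<lambda>t. link_momentum P (xd t) (\<lambda>i. qd i t) i) has_vector_derivative
        link_momentum P (xdd t) (\<lambda>i. qdd i t) i) (at t within ?T)" for i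
      unfolding body_momentum_def link_momentum_def
      by (intro has_vector_derivative_add has_vector_derivative_sum
          bounded_linear.has_vector_derivative [OF bounded_linear_scaleR_right] xd qd t; assumption)+
    show ?thesis
      unfolding K_def K'_def
      by (intro mom has_vector_derivative_add has_vector_derivative_sum has_vector_derivative_inner
          has_vector_derivative_matrix_vector_mult \<Omega> d\<eta> t
          C1_family_mixed_partial [OF X Xt 0 t] C1_family_mixed_partial [OF Q Qt 0 t]; assumption)
  qed
  have "(K' has_integral K tf - K t0) ?T"
    by (rule fundamental_theorem_of_calculus) (use time K in auto)
  moreover have "K tf = 0" "K t0 = 0"
    unfolding K_def by (simp_all add: Xs0 [OF t0tf(1)] Xs0 [OF t0tf(2)] Qs0 [OF _ t0tf(1)] Qs0 [OF _ t0tf(2)] ends)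
  ultimately have K'_int: "(K' has_integral 0) ?T"
    by simp

  let ?force = "\<lambda>t. (- f t *\<^sub>R (R t *v e3)) \<bullet> \<delta>x t + M t \<bullet> \<eta> t"
  \<comment> \<open>Continuity of the variation, inherited from the family, makes the virtual work
    integrable.\<close>
  have "continuous_on ?T (Xs 0)"
    by (rule continuous_on_slice [OF C1_familyD(3) [OF X] 0])
  then have "continuous_on ?T \<delta>x"
    by (rule continuous_on_eq) (simp add: Xs0)
  moreover have "continuous_on ?T \<eta>"
    by (rule continuous_on_vector_derivative [OF d\<eta>])
  ultimately have "continuous_on ?T ?force"
    by (intro continuous_intros f M continuous_on_curves)
  then have "(?force has_integral integral ?T ?force) ?T"
    by (intro integrable_integral integrable_continuous_real)
  moreover have "(L' 0 has_integral integral ?T (L' 0)) ?T"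
    by (intro integrable_integral integrable_continuous_real continuous_on_slice [OF contL' 0])
  ultimately have int: "((\<lambda>t. L' 0 t + ?force t - K' t) has_integral
      integral ?T (L' 0) + integral ?T ?force - 0) ?T"
    by (intro has_integral_diff has_integral_add K'_int)
  \<comment> \<open>The terms with \<open>Xts\<close>, \<open>Qts\<close> and \<open>\<eta>d\<close>
    cancel pointwise.\<close>
  have residual: "L' 0 t + ?force t - K' t = position_residual t \<bullet> \<delta>x t +
      (\<Sum>i=1..?n. link_residual i t \<bullet> cross3 (\<xi> i t) (q i t)) + attitude_residual t \<bullet> \<eta> t"
    if t: "t \<in> ?T" for t
  proof -
    have mom: "body_momentum P (Xt 0 t) (\<lambda>i. Qt i 0 t) = body_momentum P (xd t) (\<lambda>i. qd i t)"
      "link_momentum P (Xt 0 t) (\<lambda>i. Qt i 0 t) i = link_momentum P (xd t) (\<lambda>i. qd i t) i" for i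
      unfolding body_momentum_def link_momentum_def
      by (intro arg_cong2 [where f = "(+)"] sum.cong refl; simp add: Xt0 [OF t] Qt0 [OF _ t])+
    \<comment> \<open>This triple product identity turns the term \<Omega> \<times> \<eta> of the
      varied angular velocity into the gyroscopic term of the attitude equation.\<close>
    have "(?J *v \<Omega> t) \<bullet> cross3 (\<Omega> t) (\<eta> t) = - (cross3 (\<Omega> t) (?J *v \<Omega> t) \<bullet> \<eta> t)"
      by (simp add: cross3_def inner_vec_def sum_3 algebra_simps)
    moreover have "(\<Sum>i=1..?n. link_weight P i * (e3 \<bullet> Qs i 0 t)) -
        (\<Sum>i=1..?n. link_momentum P (xdd t) (\<lambda>i. qdd i t) i \<bullet> Qs i 0 t) =
        (\<Sum>i=1..?n. link_residual i t \<bullet> cross3 (\<xi> i t) (q i t))"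
      unfolding sum_subtractf [symmetric]
      by (intro sum.cong) (auto simp: link_residual_def Qs0 [OF _ t] inner_diff_left)
    ultimately show ?thesis
      unfolding L'_def K'_def mom
      by (simp add: W0 [OF t] Ws0 [OF t] Xs0 [OF t] sum.distrib position_residual_def attitude_residual_def hat_mult_vec
          inner_add_left inner_add_right inner_diff_left)
  qed
  have "((\<lambda>t. position_residual t \<bullet> \<delta>x t +
      (\<Sum>i=1..?n. link_residual i t \<bullet> cross3 (\<xi> i t) (q i t)) + attitude_residual t \<bullet> \<eta> t)
      has_integral integral ?T (L' 0) + integral ?T ?force) ?T"
    using has_integral_eq [OF residual int] by simp
  then show ?thesis
    using deriv by (intro exI conjI) (assumption, rule integral_unique [symmetric])
qed

section \<open>Test variations and the equivalence with the vanishing of the residuals\<close>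

lemma C2_curves:
  "C2_curve t0 tf x" "C2_curve t0 tf R" "i \<in> {1..num_links P} \<Longrightarrow> C2_curve t0 tf (q i)"
proof -
  show "C2_curve t0 tf x"
    unfolding C2_curve_def using x xd xdd by blast
  show "C2_curve t0 tf (q i)" if "i \<in> {1..num_links P}"
    unfolding C2_curve_def using q qd qdd that by blast
  interpret m: bounded_bilinear "(**) :: real^3^3 \<Rightarrow> real^3^3 \<Rightarrow> real^3^3"
    by (rule bounded_bilinear_matrix_matrix_mult)
  let ?R'' = "\<lambda>t. R t ** hat (\<Omega>d t) + (R t ** hat (\<Omega> t)) ** hat (\<Omega> t)"
  have deriv: "((\<lambda>t. R t ** hat (\<Omega> t)) has_vector_derivative ?R'' t) (at t within {t0..tf})"
    if "t \<in> {t0..tf}" for t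
    by (rule m.has_vector_derivative [OF R [OF that]
          bounded_linear.has_vector_derivative [OF bounded_linear_hat \<Omega> [OF that]]])
  have cont: "continuous_on {t0..tf} ?R''"
    by (intro continuous_on_add m.continuous_on continuous_on_curves \<Omega>d
        bounded_linear.continuous_on [OF bounded_linear_hat])
  show "C2_curve t0 tf R"
    unfolding C2_curve_def by (intro exI conjI ballI) (erule R, erule deriv, rule cont)
qed

text \<open>The weights \<open>\<alpha>\<close>, \<open>\<beta>\<close>, \<open>\<gamma> i\<close> select which of the bodies is moved by the variation.\<close>

lemma variation_along_axis:
  assumes \<phi>: "C2_curve t0 tf \<phi>" "\<phi> t0 = 0" "\<phi> tf = 0"
  shows "variation (num_links P) t0 tf x R q 1
    (\<lambda>s t. x t + (s * \<phi> t) *\<^sub>R (\<alpha> *\<^sub>R axis k 1))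
    (\<lambda>s t. axis_rotation k (\<beta> * (s * \<phi> t)) ** R t)
    (\<lambda>s i t. axis_rotation k (\<gamma> i * (s * \<phi> t)) *v q i t)
    (\<lambda>t. \<phi> t *\<^sub>R (\<alpha> *\<^sub>R axis k 1))
    (\<lambda>t. (\<beta> * \<phi> t) *\<^sub>R (transpose (R t) *v axis k 1))
    (\<lambda>i t. (\<gamma> i * \<phi> t) *\<^sub>R (axis k 1 - (axis k 1 \<bullet> q i t) *\<^sub>R q i t))"
proof -
  have "C2_family 1 t0 tf (\<lambda>s t. (\<lambda>_. 1) (s * \<phi> t) *\<^sub>R x t)"
    by (rule C2_family_scaleR [where G' = "\<lambda>_. 0" and G'' = "\<lambda>_. 0", OF _ _ _ \<phi>(1) C2_curves(1)]) auto
  moreover have const: "C2_curve t0 tf (\<lambda>t. \<alpha> *\<^sub>R axis k 1 :: real^3)"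
    unfolding C2_curve_def by (intro exI [of _ "\<lambda>_. 0"]) auto
  have "C2_family 1 t0 tf (\<lambda>s t. (s * \<phi> t) *\<^sub>R (\<alpha> *\<^sub>R axis k 1 :: real^3))"
    by (rule C2_family_scaleR [where G = "\<lambda>y. y" and G' = "\<lambda>_. 1" and G'' = "\<lambda>_. 0", OF _ _ _ \<phi>(1) const])
      auto
  ultimately have X: "C2_family 1 t0 tf (\<lambda>s t. x t + (s * \<phi> t) *\<^sub>R (\<alpha> *\<^sub>R axis k 1))"
    using C2_family_add by fastforce
  have A: "C2_family 1 t0 tf (\<lambda>s t. axis_rotation k (\<beta> * (s * \<phi> t)) ** R t)"
    by (rule C2_family_axis_rotation [OF bounded_bilinear_matrix_matrix_mult _ \<phi>(1) C2_curves(2)]) simp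
  have Q: "C2_family 1 t0 tf (\<lambda>s t. axis_rotation k (\<gamma> i * (s * \<phi> t)) *v q i t)"
    if "i \<in> {1..num_links P}" for i
    by (rule C2_family_axis_rotation [OF bounded_bilinear_matrix_vector_mult _ \<phi>(1) C2_curves(3) [OF that]])
      simp
  have dX: "((\<lambda>s. x t + (s * \<phi> t) *\<^sub>R (\<alpha> *\<^sub>R axis k 1)) has_vector_derivative
      \<phi> t *\<^sub>R (\<alpha> *\<^sub>R axis k 1)) (at 0)" for t
    by (auto intro!: derivative_eq_intros)
  \<comment> \<open>The rotation acts on the left, about an inertial axis, so in the body frame its
    generator is the axis pulled back by \<open>transpose (R t)\<close>.\<close>
  have dA: "((\<lambda>s. axis_rotation k (\<beta> * (s * \<phi> t)) ** R t) has_vector_derivative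
      R t ** hat ((\<beta> * \<phi> t) *\<^sub>R (transpose (R t) *v axis k 1))) (at 0)" if "t \<in> {t0..tf}" for t
    using axis_rotation_apply_has_vector_derivative [OF bounded_bilinear_matrix_matrix_mult,
        of k \<beta> "\<phi> t" "R t"]
    unfolding hat_matrix_mult_rotation [OF R_SO3 [OF that]] hat_scaleR
      bounded_bilinear.scaleR_right [OF bounded_bilinear_matrix_matrix_mult] .
  \<comment> \<open>Subtracting from the axis its component along \<open>q i\<close> makes
    \<open>\<xi> i\<close> orthogonal to \<open>q i\<close> without changing its cross product with
    \<open>q i\<close>.\<close>
  have dQ: "((\<lambda>s. axis_rotation k (\<gamma> i * (s * \<phi> t)) *v q i t) has_vector_derivative
      cross3 ((\<gamma> i * \<phi> t) *\<^sub>R (axis k 1 - (axis k 1 \<bullet> q i t) *\<^sub>R q i t)) (q i t)) (at 0)" for i t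
    using axis_rotation_apply_has_vector_derivative [OF bounded_bilinear_matrix_vector_mult,
        of k "\<gamma> i" "\<phi> t" "q i t"]
    by (simp add: hat_mult_vec cross_mult_left Cross3.left_diff_distrib)
  have orth: "((\<gamma> i * \<phi> t) *\<^sub>R (axis k 1 - (axis k 1 \<bullet> q i t) *\<^sub>R q i t)) \<bullet> q i t = 0"
    if "i \<in> {1..num_links P}" "t \<in> {t0..tf}" for i t
    using q_S2 [OF that] by (simp add: inner_diff_left norm_eq_1)
  have rot: "rotation_matrix (axis_rotation k (\<beta> * (s * \<phi> t)) ** R t)" if "t \<in> {t0..tf}" for s t
    by (intro rotation_matrix_mult rotation_matrix_axis_rotation R_SO3 that)
  have unit: "norm (axis_rotation k (\<gamma> i * (s * \<phi> t)) *v q i t) = 1"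
    if "i \<in> {1..num_links P}" "t \<in> {t0..tf}" for i s t
    using q_S2 [OF that] by (simp add: norm_rotation_matrix [OF rotation_matrix_axis_rotation])
  show ?thesis
    unfolding variation_def
    by (intro conjI ballI zero_less_one X A Q dX dA dQ orth rot unit; (assumption | use \<phi>(2,3) in auto))
qed

text \<open>Along the test variation about axis \<open>k\<close>, the first variation plus virtual
  work is the integral of \<open>\<phi>\<close> times this scalar, so the fundamental lemma applies.
  The weights stay free so that each residual can be selected later.\<close>

lemma variation_residuals_vanish:
  assumes "lagrange_dalembert P t0 tf f M x R q" and t: "t \<in> {t0..tf}"
  shows "\<alpha> * position_residual t $ k +
    (\<Sum>i=1..num_links P. \<gamma> i * cross3 (q i t) (link_residual i t) $ k) +
    \<beta> * (R t *v attitude_residual t) $ k = 0"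
proof (rule fundamental_lemma_calculus_of_variations [OF time _ _ t])
  let ?h = "\<lambda>t. \<alpha> * position_residual t $ k +
    (\<Sum>i=1..num_links P. \<gamma> i * cross3 (q i t) (link_residual i t) $ k) +
    \<beta> * (R t *v attitude_residual t) $ k"
  show "continuous_on {t0..tf} ?h"
    by (intro continuous_intros continuous_on_cross continuous_on_residuals continuous_on_curves;
      assumption)
  fix \<phi> :: "real \<Rightarrow> real" assume \<phi>: "C2_curve t0 tf \<phi>" "\<phi> t0 = 0" "\<phi> tf = 0"
  note var = variation_along_axis [OF \<phi>, of \<alpha> k \<beta> \<gamma>]
  let ?\<delta>x = "\<lambda>t. \<phi> t *\<^sub>R (\<alpha> *\<^sub>R axis k 1) :: real^3"
    and ?\<eta> = "\<lambda>t. (\<beta> * \<phi> t) *\<^sub>R (transpose (R t) *v axis k 1)"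
    and ?\<xi> = "\<lambda>i t. (\<gamma> i * \<phi> t) *\<^sub>R (axis k 1 - (axis k 1 \<bullet> q i t) *\<^sub>R q i t)"
  obtain D where D: "((\<lambda>s. action P t0 tf (\<lambda>t. x t + (s * \<phi> t) *\<^sub>R (\<alpha> *\<^sub>R axis k 1))
      (\<lambda>t. axis_rotation k (\<beta> * (s * \<phi> t)) ** R t)
      (\<lambda>i t. axis_rotation k (\<gamma> i * (s * \<phi> t)) *v q i t)) has_real_derivative D) (at 0)"
    "D + integral {t0..tf} (\<lambda>t. (- f t *\<^sub>R (R t *v e3)) \<bullet> ?\<delta>x t + M t \<bullet> ?\<eta> t) = 0"
    using assms(1) [unfolded lagrange_dalembert_def, rule_format, OF var] by (elim exE conjE)
  from first_variation [OF var] have "integral {t0..tf} (\<lambda>t. position_residual t \<bullet> ?\<delta>x t +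
      (\<Sum>i=1..num_links P. link_residual i t \<bullet> cross3 (?\<xi> i t) (q i t)) +
      attitude_residual t \<bullet> ?\<eta> t) = 0"
  proof (elim exE conjE)
    \<comment> \<open>The derivative supplied by the principle and the one computed by
      \<open>first_variation\<close> agree by uniqueness.\<close>
    fix D' assume "((\<lambda>s. action P t0 tf (\<lambda>t. x t + (s * \<phi> t) *\<^sub>R (\<alpha> *\<^sub>R axis k 1))
        (\<lambda>t. axis_rotation k (\<beta> * (s * \<phi> t)) ** R t)
        (\<lambda>i t. axis_rotation k (\<gamma> i * (s * \<phi> t)) *v q i t)) has_real_derivative D') (at 0)"
      and D': "D' + integral {t0..tf} (\<lambda>t. (- f t *\<^sub>R (R t *v e3)) \<bullet> ?\<delta>x t + M t \<bullet> ?\<eta> t) =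
        integral {t0..tf} (\<lambda>t. position_residual t \<bullet> ?\<delta>x t +
          (\<Sum>i=1..num_links P. link_residual i t \<bullet> cross3 (?\<xi> i t) (q i t)) +
          attitude_residual t \<bullet> ?\<eta> t)"
    from this(1) D(1) have "D' = D"
      by (rule DERIV_unique)
    show ?thesis
      unfolding D' [symmetric] \<open>D' = D\<close> by (rule D(2))
  qed
  moreover have "position_residual t \<bullet> ?\<delta>x t +
      (\<Sum>i=1..num_links P. link_residual i t \<bullet> cross3 (?\<xi> i t) (q i t)) +
      attitude_residual t \<bullet> ?\<eta> t = \<phi> t * ?h t" for t
  proof -
    have "link_residual i t \<bullet> cross3 (?\<xi> i t) (q i t) =
        \<phi> t * (\<gamma> i * cross3 (q i t) (link_residual i t) $ k)" for i
    proof -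
      have "cross3 (?\<xi> i t) (q i t) = (\<phi> t * \<gamma> i) *\<^sub>R cross3 (axis k 1) (q i t)"
        by (simp add: cross_mult_left Cross3.left_diff_distrib mult.commute)
      \<comment> \<open>Cyclic symmetry of the triple product.\<close>
      moreover have "link_residual i t \<bullet> cross3 (axis k 1) (q i t) =
          cross3 (q i t) (link_residual i t) \<bullet> axis k 1"
        using cross_triple [of "axis k 1" "q i t" "link_residual i t"] by (simp add: inner_commute)
      ultimately show ?thesis
        by (simp add: inner_axis)
    qed
    moreover have "attitude_residual t \<bullet> (transpose (R t) *v axis k 1) = (R t *v attitude_residual t) $ k"
      by (simp add: dot_lmul_matrix inner_commute [of "attitude_residual t"] inner_axis')
    ultimately show ?thesis
      by (simp add: inner_axis distrib_left sum_distrib_left)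
  qed
  ultimately show "integral {t0..tf} (\<lambda>t. \<phi> t * ?h t) = 0"
    by simp
qed

text \<open>One direction takes weights 0 and 1 in the test variations. In the other, every term of
  the integrand in \<open>first_variation\<close> vanishes at each time.\<close>

lemma lagrange_dalembert_iff_residuals:
  "lagrange_dalembert P t0 tf f M x R q \<longleftrightarrow>
    (\<forall>t\<in>{t0..tf}. position_residual t = 0 \<and>
      (\<forall>i\<in>{1..num_links P}. cross3 (q i t) (link_residual i t) = 0) \<and> attitude_residual t = 0)"
proof (intro iffI ballI)
  fix t assume ld: "lagrange_dalembert P t0 tf f M x R q" and t: "t \<in> {t0..tf}"
  note vanish = variation_residuals_vanish [OF ld t]
  have "position_residual t $ k = 0" for k
    using vanish [of 1 k "\<lambda>_. 0" 0] by simp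
  moreover have "cross3 (q i t) (link_residual i t) $ k = 0" if "i \<in> {1..num_links P}" for i k
    using vanish [of 0 k "\<lambda>j. if j = i then 1 else 0" 0] that
    by (simp add: if_distrib [of "\<lambda>c. c * _"] cong: if_cong)
  \<comment> \<open>The test variations turn about inertial axes and so see the attitude residual
    rotated by \<open>R t\<close>; rotations preserve norms, so the residual itself is 0.\<close>
  moreover have "(R t *v attitude_residual t) $ k = 0" for k
    using vanish [of 0 k "\<lambda>_. 0" 1] by simp
  then have "R t *v attitude_residual t = 0"
    by (simp add: vec_eq_iff)
  then have "attitude_residual t = 0"
    using norm_rotation_matrix [OF R_SO3 [OF t], of "attitude_residual t"] by simp
  ultimately show "position_residual t = 0 \<and>
      (\<forall>i\<in>{1..num_links P}. cross3 (q i t) (link_residual i t) = 0) \<and> attitude_residual t = 0"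
    by (simp add: vec_eq_iff)
next
  assume res: "\<forall>t\<in>{t0..tf}. position_residual t = 0 \<and>
      (\<forall>i\<in>{1..num_links P}. cross3 (q i t) (link_residual i t) = 0) \<and> attitude_residual t = 0"
  show "lagrange_dalembert P t0 tf f M x R q"
    unfolding lagrange_dalembert_def
  proof (intro allI impI)
    fix e X A Q \<delta>x \<eta> \<xi> assume var: "variation (num_links P) t0 tf x R q e X A Q \<delta>x \<eta> \<xi>"
    \<comment> \<open>By cyclic symmetry the term is \<open>\<xi> i t\<close> paired with
      \<open>cross3 (q i t) (link_residual i t)\<close>, which is 0.\<close>
    have "link_residual i t \<bullet> cross3 (\<xi> i t) (q i t) = 0" if "i \<in> {1..num_links P}" "t \<in> {t0..tf}" for i t
      using cross_triple [of "\<xi> i t" "q i t" "link_residual i t"] res that by (simp add: inner_commute)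
    then have "integral {t0..tf} (\<lambda>t. position_residual t \<bullet> \<delta>x t +
        (\<Sum>i=1..num_links P. link_residual i t \<bullet> cross3 (\<xi> i t) (q i t)) + attitude_residual t \<bullet> \<eta> t) =
      integral {t0..tf} (\<lambda>t. 0)"
      using res by (intro integral_cong) simp
    with first_variation [OF var]
    show "\<exists>D. ((\<lambda>s. action P t0 tf (X s) (A s) (Q s)) has_real_derivative D) (at 0) \<and>
        D + integral {t0..tf} (\<lambda>t. (- f t *\<^sub>R (R t *v e3)) \<bullet> \<delta>x t + M t \<bullet> \<eta> t) = 0"
      by simp
  qed
qed

end

theorem proposition1:
  fixes P :: quadrotor
    and t0 tf :: real
    and f :: "real \<Rightarrow> real"
    and M :: "real \<Rightarrow> real^3"
    and x xd xdd :: "real \<Rightarrow> real^3"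
    and R :: "real \<Rightarrow> real^3^3"
    and \<Omega> \<Omega>d :: "real \<Rightarrow> real^3"
    and q qd qdd :: "nat \<Rightarrow> real \<Rightarrow> real^3"
  assumes n: "num_links P \<ge> 1"
    and mass: "body_mass P > 0"
    and inertia_sym: "transpose (body_inertia P) = body_inertia P"
    and inertia_pos: "\<And>v. v \<noteq> 0 \<Longrightarrow> v \<bullet> (body_inertia P *v v) > 0"
    and link_mass: "\<And>i. i \<in> {1..num_links P} \<Longrightarrow> link_mass P i > 0"
    and link_length: "\<And>i. i \<in> {1..num_links P} \<Longrightarrow> link_length P i > 0"
    and time: "t0 < tf"
    and f: "continuous_on {t0..tf} f"
    and M: "continuous_on {t0..tf} M"
    and x: "\<And>t. t \<in> {t0..tf} \<Longrightarrow> (x has_vector_derivative xd t) (at t within {t0..tf})"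
    and xd: "\<And>t. t \<in> {t0..tf} \<Longrightarrow> (xd has_vector_derivative xdd t) (at t within {t0..tf})"
    and xdd: "continuous_on {t0..tf} xdd"
    and R_SO3: "\<And>t. t \<in> {t0..tf} \<Longrightarrow> rotation_matrix (R t)"
    and R: "\<And>t. t \<in> {t0..tf} \<Longrightarrow> (R has_vector_derivative R t ** hat (\<Omega> t)) (at t within {t0..tf})"
    and \<Omega>: "\<And>t. t \<in> {t0..tf} \<Longrightarrow> (\<Omega> has_vector_derivative \<Omega>d t) (at t within {t0..tf})"
    and \<Omega>d: "continuous_on {t0..tf} \<Omega>d"
    and q_S2: "\<And>i t. i \<in> {1..num_links P} \<Longrightarrow> t \<in> {t0..tf} \<Longrightarrow> norm (q i t) = 1"
    and q: "\<And>i t. i \<in> {1..num_links P} \<Longrightarrow> t \<in> {t0..tf} \<Longrightarrow>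
              (q i has_vector_derivative qd i t) (at t within {t0..tf})"
    and qd: "\<And>i t. i \<in> {1..num_links P} \<Longrightarrow> t \<in> {t0..tf} \<Longrightarrow>
              (qd i has_vector_derivative qdd i t) (at t within {t0..tf})"
    and qdd: "\<And>i. i \<in> {1..num_links P} \<Longrightarrow> continuous_on {t0..tf} (qdd i)"
  shows "(lagrange_dalembert P t0 tf f M x R q \<longleftrightarrow>
           (\<forall>t\<in>{t0..tf}.
              position_equation P (f t) (R t) (xdd t) (\<lambda>i. qdd i t) \<and>
              (\<forall>i\<in>{1..num_links P}.
                 link_equation P (xdd t) (\<lambda>i. q i t) (\<lambda>i. qd i t) (\<lambda>i. qdd i t) i) \<and>
              attitude_equation P (M t) (\<Omega> t) (\<Omega>d t))) \<and>
         (\<forall>t\<in>{t0..tf}.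
            (position_equation P (f t) (R t) (xdd t) (\<lambda>i. qdd i t) \<and>
             (\<forall>i\<in>{1..num_links P}.
                link_equation P (xdd t) (\<lambda>i. q i t) (\<lambda>i. qd i t) (\<lambda>i. qdd i t) i)) \<longleftrightarrow>
            direction_matrix_equation P (f t) (R t) (xdd t)
              (\<lambda>i. q i t) (\<lambda>i. qd i t) (\<lambda>i. qdd i t)) \<and>
         (\<exists>\<omega> \<omega>d. link_angular_velocities (num_links P) t0 tf q \<omega> \<omega>d) \<and>
         (\<forall>\<omega> \<omega>d. link_angular_velocities (num_links P) t0 tf q \<omega> \<omega>d \<longrightarrow>
            (\<forall>t\<in>{t0..tf}.
               (position_equation P (f t) (R t) (xdd t) (\<lambda>i. qdd i t) \<and>
                (\<forall>i\<in>{1..num_links P}.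
                   link_equation P (xdd t) (\<lambda>i. q i t) (\<lambda>i. qd i t) (\<lambda>i. qdd i t) i)) \<longleftrightarrow>
               velocity_matrix_equation P (f t) (R t) (xdd t)
                 (\<lambda>i. q i t) (\<lambda>i. \<omega> i t) (\<lambda>i. \<omega>d i t)))"
proof -
  interpret quadrotor_motion P t0 tf f M x xd xdd R \<Omega> \<Omega>d q qd qdd
    using assms by unfold_locales auto
  have velocity: "velocity_matrix_equation P (f t) (R t) (xdd t) (\<lambda>i. q i t) (\<lambda>i. \<omega> i t) (\<lambda>i. \<omega>d i t) \<longleftrightarrow>
      position_equation P (f t) (R t) (xdd t) (\<lambda>i. qdd i t) \<and>
      (\<forall>i\<in>{1..num_links P}. link_equation P (xdd t) (\<lambda>i. q i t) (\<lambda>i. qd i t) (\<lambda>i. qdd i t) i)"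
    if "link_angular_velocities (num_links P) t0 tf q \<omega> \<omega>d" and t: "t \<in> {t0..tf}" for \<omega> \<omega>d t
  proof -
    \<comment> \<open>The link equations and the rows in angular velocities meet in the condition
      that the residual crossed with \<open>q i\<close> is 0.\<close>
    have "velocity_matrix_equation P (f t) (R t) (xdd t) (\<lambda>i. q i t) (\<lambda>i. \<omega> i t) (\<lambda>i. \<omega>d i t) \<longleftrightarrow>
        position_equation P (f t) (R t) (xdd t) (\<lambda>i. qdd i t) \<and>
        (\<forall>i\<in>{1..num_links P}. cross3 (q i t) (link_residual i t) = 0)"
      unfolding link_residual_def
      by (rule velocity_matrix_equation_iff)
        (use q_S2 link_angular_velocitiesD [OF that(1)] t in blast)+
    then show ?thesis
      using equations_iff_residuals(2) [OF t] by blast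
  qed
  have "lagrange_dalembert P t0 tf f M x R q \<longleftrightarrow>
      (\<forall>t\<in>{t0..tf}.
         position_equation P (f t) (R t) (xdd t) (\<lambda>i. qdd i t) \<and>
         (\<forall>i\<in>{1..num_links P}.
            link_equation P (xdd t) (\<lambda>i. q i t) (\<lambda>i. qd i t) (\<lambda>i. qdd i t) i) \<and>
         attitude_equation P (M t) (\<Omega> t) (\<Omega>d t))"
    unfolding lagrange_dalembert_iff_residuals
    by (intro ball_cong refl conj_cong equations_iff_residuals [symmetric])
  then show ?thesis
    using direction_matrix_equation_iff link_angular_velocities_exist velocity by blast
qed

end
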